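(* Let $T$ be a tree of height $\omega_1$. If $T$ contains an uncountable subset $S$ which is $\omega_1$-compact in the subspace topology (in particular, if $T$ is a Suslin tree), then the road space $R_T$ of $T$ is not contractible.
   Context: A tree $T$ is a partially ordered set such that the set of predecessors of each point is well ordered. Trees are assumed to be Hausdorff: if $x,y\in T$ are at a limit level and have the same predecessors, then $x=y$. Trees carry the order (interval) topology. A tree is Suslin if it has height $\omega_1$ and all its chains and antichains are at most countable. A space is $\omega_1$-compact iff each of its closed discrete subsets is at most countable. Road space. The road space $R_T$ of a tree $T$ is obtained from $T$ by joining each pair of consecutive points $x<y$ of $T$ (that is, $y$ is an immediate successor of $x$) by a copy ${}_x[0,1]_y$ of the interval $[0,1]$, with $0$ glued to $x$ and $1$ glued to $y$; the order of $T$ is extended to $R_T$ in the obvious way. For $A\subset[0,1]$, ${}_xA_y$ denotes the corresponding subset of ${}_x[0,1]_y$. $T$ is regarded as a subset of $R_T$. For $x\in T$ let $s(x)$ be the set of its immediate successors and, for $n\ge 1$, $W_{x,n}=\{x\}\cup\bigcup_{y\in s(x)}{}_x[0,1/n)_y$. The topology of $R_T$ is as follows. The interior ${}_x(0,1)_y$ of each added interval is open and has the usual topology of $(0,1)$. If $x\in s(z)$ with $z\in T$, a neighborhood base at $x$ is $\{W_{x,n}\cup{}_z(1-1/n,1]_x : n\ge 1\}$. If $x$ is minimal in $T$, a neighborhood base at $x$ is $\{W_{x,n}: n\ge1\}$. If $x\in T$ is at a limit level, a neighborhood base at $x$ is given by the sets $\{y\in R_T: z<y\le x\}\cup\bigcup\{W_{w,n}: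 w\in T,\ z<w\le x\}$ for $z\in T$, $z<x$, $n\ge1$. A space $X$ is contractible if there is a continuous $h\colon X\times[0,1]\to X$ such that $h(x,1)=x$ for all $x\in X$ and $h(\cdot,0)$ is constant. *)

theory Defs
  imports "HOL-Analysis.Analysis"
begin

section \<open>Trees\<close>

text \<open>A tree is given by its reflexive order relation \<open>r\<close>, where \<open>(x, y) \<in> r\<close> means \<open>x \<le> y\<close>;
  the underlying set is \<open>Field r\<close>, and \<open>underS r x\<close> is the set of predecessors of \<open>x\<close>.\<close>

definition is_tree :: "'a rel \<Rightarrow> bool" where
  "is_tree r \<longleftrightarrow> Partial_order r \<and>
     (\<forall>x\<in>Field r. well_order_on (underS r x) (Restr r (underS r x)))"

definition minimal_points :: "'a rel \<Rightarrow> 'a set" where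
  "minimal_points r = {x \<in> Field r. underS r x = {}}"

definition immediate_succs :: "'a rel \<Rightarrow> 'a \<Rightarrow> 'a set" where
  "immediate_succs r x = {y. x \<in> underS r y \<and> (\<nexists>z. x \<in> underS r z \<and> z \<in> underS r y)}"

text \<open>The level of \<open>x\<close> is the order type of its predecessors; this is a (nonzero) limit ordinal
  iff there is a predecessor but no largest one. Minimal points are not at a limit level.\<close>

definition limit_level_points :: "'a rel \<Rightarrow> 'a set" where
  "limit_level_points r = {x \<in> Field r. underS r x \<noteq> {} \<and>
     (\<forall>y\<in>underS r x. \<exists>z\<in>underS r x. y \<in> underS r z)}"

definition hausdorff_tree :: "'a rel \<Rightarrow> bool" where
  "hausdorff_tree r \<longleftrightarrow> is_tree r \<and>
     (\<forall>x\<in>limit_level_points r. \<forall>y\<in>limit_level_points r. underS r x = underS r y \<longrightarrow> x = y)"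

text \<open>Ordinals are represented by well-order relations, compared up to isomorphism by
  \<open>ordIso\<close> and \<open>ordLess\<close>. The height is the least ordinal whose level is empty. Each ordinal
  below \<open>\<kappa>\<close> is isomorphic to an initial segment of \<open>\<kappa>\<close>, so that it suffices to quantify
  over relations of the type of \<open>\<kappa>\<close>.\<close>

definition tree_level :: "'a rel \<Rightarrow> 'b rel \<Rightarrow> 'a set" where
  "tree_level r \<alpha> = {x \<in> Field r. (Restr r (underS r x), \<alpha>) \<in> ordIso}"

definition has_height :: "'a rel \<Rightarrow> 'b rel \<Rightarrow> bool" where
  "has_height r \<kappa> \<longleftrightarrow> Well_order \<kappa> \<and> tree_level r \<kappa> = {} \<and>
     (\<forall>\<alpha> :: 'b rel. (\<alpha>, \<kappa>) \<in> ordLess \<longrightarrow> tree_level r \<alpha> \<noteq> {})"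

definition omega1 :: "nat set rel" where
  "omega1 = cardSuc natLeq"

definition antichain :: "'a rel \<Rightarrow> 'a set \<Rightarrow> bool" where
  "antichain r A \<longleftrightarrow> A \<subseteq> Field r \<and> (\<forall>x\<in>A. \<forall>y\<in>A. x \<noteq> y \<longrightarrow> (x, y) \<notin> r)"

definition suslin_tree :: "'a rel \<Rightarrow> bool" where
  "suslin_tree r \<longleftrightarrow> hausdorff_tree r \<and> has_height r omega1 \<and>
     (\<forall>C\<in>Chains r. countable C) \<and> (\<forall>A. antichain r A \<longrightarrow> countable A)"

text \<open>The order (interval) topology has as base the half-open intervals \<open>(z, x]\<close> and the
  singletons of minimal points.\<close>

definition tree_topology :: "'a rel \<Rightarrow> 'a topology" where
  "tree_topology r = topology_generated_by
     ({{y. z \<in> underS r y \<and> (y, x) \<in> r} | z x. z \<in> underS r x} \<union> {{x} | x. x \<in> minimal_points r})"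

definition omega1_compact_space :: "'a topology \<Rightarrow> bool" where
  "omega1_compact_space X \<longleftrightarrow>
     (\<forall>D. closedin X D \<and> subtopology X D = discrete_topology D \<longrightarrow> countable D)"


section \<open>Road spaces\<close>

text \<open>\<open>Node x\<close> is the point \<open>x\<close> of the tree, and \<open>Edge x y t\<close> with \<open>0 < t < 1\<close> is the
  point with parameter \<open>t\<close> in the interior of the interval joining \<open>x\<close> to \<open>y\<close>. The gluing of the
  endpoints is built into \<open>road_point\<close>.\<close>

datatype 'a road = Node 'a | Edge 'a 'a real

definition road_point :: "'a \<Rightarrow> 'a \<Rightarrow> real \<Rightarrow> 'a road" where
  "road_point x y t = (if t = 0 then Node x else if t = 1 then Node y else Edge x y t)"

abbreviation road_seg :: "'a \<Rightarrow> 'a \<Rightarrow> real set \<Rightarrow> 'a road set" where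
  "road_seg x y A \<equiv> road_point x y ` A"

definition road_space :: "'a rel \<Rightarrow> 'a road set" where
  "road_space r = Node ` Field r \<union> (\<Union>x\<in>Field r. \<Union>y\<in>immediate_succs r x. road_seg x y {0..1})"

fun road_less :: "'a rel \<Rightarrow> 'a road \<Rightarrow> 'a road \<Rightarrow> bool" where
  "road_less r (Node x) (Node y) \<longleftrightarrow> x \<in> underS r y"
| "road_less r (Node z) (Edge x y t) \<longleftrightarrow> (z, x) \<in> r"
| "road_less r (Edge x y t) (Node z) \<longleftrightarrow> (y, z) \<in> r"
| "road_less r (Edge x y t) (Edge x' y' t') \<longleftrightarrow> (y, x') \<in> r \<or> x = x' \<and> y = y' \<and> t < t'"

definition road_star :: "'a rel \<Rightarrow> 'a \<Rightarrow> nat \<Rightarrow> 'a road set" where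
  "road_star r x n = insert (Node x) (\<Union>y\<in>immediate_succs r x. road_seg x y {0..<1 / real n})"

fun road_nbhd_base :: "'a rel \<Rightarrow> 'a road \<Rightarrow> 'a road set set" where
  "road_nbhd_base r (Edge x y t) =
     {road_seg x y {a<..<b} | a b. 0 \<le> a \<and> a < t \<and> t < b \<and> b \<le> 1}"
| "road_nbhd_base r (Node x) =
     {road_star r x n | n. x \<in> minimal_points r \<and> n \<ge> 1}
   \<union> {road_star r x n \<union> road_seg z x {1 - 1 / real n<..1} | z n. x \<in> immediate_succs r z \<and> n \<ge> 1}
   \<union> {{p \<in> road_space r. road_less r (Node z) p \<and> (road_less r p (Node x) \<or> p = Node x)}
        \<union> (\<Union>w \<in> {w. z \<in> underS r w \<and> (w, x) \<in> r}. road_star r w n)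
        | z n. x \<in> limit_level_points r \<and> z \<in> underS r x \<and> n \<ge> 1}"

definition road_open :: "'a rel \<Rightarrow> 'a road set \<Rightarrow> bool" where
  "road_open r U \<longleftrightarrow> U \<subseteq> road_space r \<and> (\<forall>p\<in>U. \<exists>N\<in>road_nbhd_base r p. N \<subseteq> U)"

definition road_topology :: "'a rel \<Rightarrow> 'a road topology" where
  "road_topology r = topology (road_open r)"


subsection \<open>The road topology is well defined, with the given neighborhood bases\<close>

lemma underS_Field1: "x \<in> underS r y \<Longrightarrow> x \<in> Field r"
  and underS_Field2: "x \<in> underS r y \<Longrightarrow> y \<in> Field r"
  by (auto simp: underS_def Field_def)

lemma immediate_succs_Field:
  assumes "y \<in> immediate_succs r x" shows "x \<in> Field r" "y \<in> Field r"
  using assms by (auto simp: immediate_succs_def underS_def Field_def)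

context
  fixes r :: "'a rel"
  assumes tree: "is_tree r"
begin

lemma tree_refl: "x \<in> Field r \<Longrightarrow> (x, x) \<in> r"
  using tree by (auto simp: is_tree_def partial_order_on_def preorder_on_def refl_on_def)

lemma tree_trans: "(x, y) \<in> r \<Longrightarrow> (y, z) \<in> r \<Longrightarrow> (x, z) \<in> r"
  using tree by (auto simp: is_tree_def partial_order_on_def preorder_on_def dest: transD)

lemma tree_antisym: "(x, y) \<in> r \<Longrightarrow> (y, x) \<in> r \<Longrightarrow> x = y"
  using tree by (auto simp: is_tree_def partial_order_on_def dest: antisymD)

lemma tree_comparable:
  assumes "y \<in> underS r x" "z \<in> underS r x"
  shows "y = z \<or> y \<in> underS r z \<or> z \<in> underS r y"
proof -
  have "well_order_on (underS r x) (Restr r (underS r x))"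
    using tree assms underS_Field2 unfolding is_tree_def by metis
  then have "total_on (underS r x) (Restr r (underS r x))"
    by (auto simp: well_order_on_def linear_order_on_def)
  then show ?thesis
    using assms by (auto simp: total_on_def underS_def)
qed

lemma underS_trans: "x \<in> underS r y \<Longrightarrow> (y, z) \<in> r \<Longrightarrow> x \<in> underS r z"
  unfolding underS_def using tree_trans tree_antisym by blast

lemma underS_trans': "(x, y) \<in> r \<Longrightarrow> y \<in> underS r z \<Longrightarrow> x \<in> underS r z"
  unfolding underS_def using tree_trans tree_antisym by blast

lemma immediate_pred_unique:
  assumes "x \<in> immediate_succs r z" "x \<in> immediate_succs r z'" shows "z = z'"
  using tree_comparable[of z x z'] assms by (auto simp: immediate_succs_def)

lemma immediate_pred_le:
  assumes "x \<in> immediate_succs r z" "w \<in> underS r x" shows "(w, z) \<in> r"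
proof -
  have "z \<in> underS r x" "z \<notin> underS r w" using assms by (auto simp: immediate_succs_def)
  then show ?thesis
    using tree_comparable[of z x w] assms tree_refl underS_Field1 by (fastforce simp: underS_def)
qed

lemma point_cases:
  assumes "x \<in> Field r"
  obtains (minimal) "x \<in> minimal_points r" | (succ) z where "x \<in> immediate_succs r z"
    | (limit) "x \<in> limit_level_points r"
  using assms unfolding minimal_points_def immediate_succs_def limit_level_points_def by blast

lemma not_minimal_succ: "x \<in> minimal_points r \<Longrightarrow> x \<notin> immediate_succs r z"
  and not_minimal_limit: "x \<in> minimal_points r \<Longrightarrow> x \<notin> limit_level_points r"
  and not_succ_limit: "x \<in> immediate_succs r z \<Longrightarrow> x \<notin> limit_level_points r"
  by (auto simp: minimal_points_def immediate_succs_def limit_level_points_def)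

lemma road_star_mono: "1 \<le> m \<Longrightarrow> m \<le> n \<Longrightarrow> road_star r x n \<subseteq> road_star r x m"
  unfolding road_star_def by (fastforce simp: frac_le intro: order.strict_trans2)

lemma edge_nbhd_baseI:
  "0 \<le> a \<Longrightarrow> a < t \<Longrightarrow> t < b \<Longrightarrow> b \<le> 1 \<Longrightarrow> road_seg x y {a<..<b} \<in> road_nbhd_base r (Edge x y t)"
  unfolding road_nbhd_base.simps by blast

lemma succ_nbhd_baseI:
  "x \<in> immediate_succs r z \<Longrightarrow> n \<ge> 1 \<Longrightarrow>
    road_star r x n \<union> road_seg z x {1 - 1 / real n<..1} \<in> road_nbhd_base r (Node x)"
  unfolding road_nbhd_base.simps by blast

lemma limit_nbhd_baseI:
  "x \<in> limit_level_points r \<Longrightarrow> z \<in> underS r x \<Longrightarrow> n \<ge> 1 \<Longrightarrow>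
    {p \<in> road_space r. road_less r (Node z) p \<and> (road_less r p (Node x) \<or> p = Node x)}
      \<union> (\<Union>w \<in> {w. z \<in> underS r w \<and> (w, x) \<in> r}. road_star r w n) \<in> road_nbhd_base r (Node x)"
  unfolding road_nbhd_base.simps by blast

lemma nbhd_base_directed:
  assumes "A \<in> road_nbhd_base r p" "B \<in> road_nbhd_base r p"
  shows "\<exists>N\<in>road_nbhd_base r p. N \<subseteq> A \<inter> B"
proof (cases p)
  case (Edge x y t)
  obtain a b a' b' where "A = road_seg x y {a<..<b}" "B = road_seg x y {a'<..<b'}"
    "0 \<le> a" "a < t" "t < b" "b \<le> 1" "0 \<le> a'" "a' < t" "t < b'" "b' \<le> 1"
    using assms Edge by auto
  then show ?thesis
    unfolding Edge
    by (intro bexI[of _ "road_seg x y {max a a'<..<min b b'}"] edge_nbhd_baseI) auto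
next
  case (Node x)
  show ?thesis
  proof (cases "x \<in> minimal_points r")
    case True
    then obtain n m where "A = road_star r x n" "B = road_star r x m" "n \<ge> 1" "m \<ge> 1"
      using assms Node not_minimal_succ not_minimal_limit by auto
    then show ?thesis
      using True road_star_mono[of n "max n m" x] road_star_mono[of m "max n m" x]
      unfolding Node by (intro bexI[of _ "road_star r x (max n m)"]) auto
  next
    case False
    show ?thesis
    proof (cases "x \<in> limit_level_points r")
      case True
      let ?N = "\<lambda>z n. {p \<in> road_space r. road_less r (Node z) p \<and> (road_less r p (Node x) \<or> p = Node x)}
        \<union> (\<Union>w \<in> {w. z \<in> underS r w \<and> (w, x) \<in> r}. road_star r w n)"
      obtain z n z' m where AB: "A = ?N z n" "B = ?N z' m" and z: "z \<in> underS r x" "z' \<in> underS r x"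
        and nm: "n \<ge> 1" "m \<ge> 1"
        using assms Node False True not_succ_limit by auto
      have mono: "?N v k \<subseteq> ?N u l" if "(u, v) \<in> r" "l \<ge> 1" "l \<le> k" for u v k l
      proof -
        have "road_less r (Node v) q \<Longrightarrow> road_less r (Node u) q" for q
          using that(1) underS_trans' tree_trans by (cases q) auto
        moreover have "v \<in> underS r w \<Longrightarrow> u \<in> underS r w" for w
          using that(1) underS_trans' by blast
        ultimately show ?thesis using road_star_mono[OF that(2,3)] by blast
      qed
      obtain u where u: "u \<in> underS r x" "(z, u) \<in> r" "(z', u) \<in> r"
      proof -
        have "(z, z) \<in> r" "(z', z') \<in> r"
          using tree_refl[OF underS_Field1[OF z(1)]] tree_refl[OF underS_Field1[OF z(2)]] by auto
        moreover have "(z, z') \<in> r \<or> (z', z) \<in> r"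
          using tree_comparable[OF z] calculation by (auto simp: underS_def)
        ultimately show ?thesis using z that[of z] that[of z'] by metis
      qed
      have "?N u (max n m) \<in> road_nbhd_base r p"
        unfolding Node by (rule limit_nbhd_baseI[OF True u(1)]) (use nm in auto)
      moreover have "?N u (max n m) \<subseteq> A \<inter> B"
        unfolding AB
        by (intro Int_greatest mono[OF u(2)] mono[OF u(3)]) (use nm in auto)
      ultimately show ?thesis by blast
    next
      case nl: False
      then obtain z n z' m where *: "A = road_star r x n \<union> road_seg z x {1 - 1 / real n<..1}"
        "B = road_star r x m \<union> road_seg z' x {1 - 1 / real m<..1}" "n \<ge> 1" "m \<ge> 1"
        "x \<in> immediate_succs r z" "x \<in> immediate_succs r z'"
        using assms Node False by auto
      then have [simp]: "z' = z" using immediate_pred_unique by blast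
      have "road_seg z x {1 - 1 / real k<..1} \<subseteq> road_seg z x {1 - 1 / real l<..1}"
        if "1 \<le> l" "l \<le> k" for k l
      proof -
        have "1 / real k \<le> 1 / real l" using that by (simp add: frac_le)
        then show ?thesis by (intro image_mono) auto
      qed
      from this[of n "max n m"] this[of m "max n m"] show ?thesis
        using * road_star_mono[of n "max n m" x] road_star_mono[of m "max n m" x]
        unfolding Node
        by (intro bexI[of _ "road_star r x (max n m) \<union> road_seg z x {1 - 1 / real (max n m)<..1}"]
            succ_nbhd_baseI) auto
    qed
  qed
qed

lemma road_openE:
  assumes "road_open r U" "p \<in> U"
  obtains N where "N \<in> road_nbhd_base r p" "N \<subseteq> U"
  using bspec[OF conjunct2[OF assms(1)[unfolded road_open_def]] assms(2)] by (elim bexE)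

lemma istopology_road_open: "istopology (road_open r)"
  unfolding istopology_def
proof (intro conjI allI impI)
  fix S T assume *: "road_open r S" "road_open r T"
  have "\<exists>N\<in>road_nbhd_base r p. N \<subseteq> S \<inter> T"
    if pS: "p \<in> S" and pT: "p \<in> T" for p
  proof -
    obtain A where "A \<in> road_nbhd_base r p" "A \<subseteq> S"
      by (rule road_openE[OF *(1) pS])
    moreover obtain B where "B \<in> road_nbhd_base r p" "B \<subseteq> T"
      by (rule road_openE[OF *(2) pT])
    ultimately obtain N where "N \<in> road_nbhd_base r p" "N \<subseteq> A \<inter> B"
      using nbhd_base_directed by metis
    with \<open>A \<subseteq> S\<close> \<open>B \<subseteq> T\<close> show ?thesis by (intro bexI[of _ N]) auto
  qed
  moreover have "S \<inter> T \<subseteq> road_space r"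
    using *(1) by (auto simp: road_open_def)
  ultimately show "road_open r (S \<inter> T)"
    by (simp add: road_open_def)
next
  fix \<K> assume *: "\<forall>K\<in>\<K>. road_open r K"
  show "road_open r (\<Union>\<K>)"
    unfolding road_open_def
  proof (intro conjI ballI)
    show "\<Union>\<K> \<subseteq> road_space r" using * by (auto simp: road_open_def)
    fix p assume "p \<in> \<Union>\<K>"
    then obtain K where "K \<in> \<K>" "p \<in> K" by blast
    then obtain N where "N \<in> road_nbhd_base r p" "N \<subseteq> K"
      using * road_openE by metis
    then show "\<exists>N\<in>road_nbhd_base r p. N \<subseteq> \<Union>\<K>"
      using \<open>K \<in> \<K>\<close> by (intro bexI[of _ N]) auto
  qed
qed

lemma openin_road_topology: "openin (road_topology r) = road_open r"
  unfolding road_topology_def by (rule topology_inverse'[OF istopology_road_open])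

lemma road_point_simps [simp]: "road_point x y 0 = Node x" "road_point x y 1 = Node y"
  by (simp_all add: road_point_def)

lemma road_nbhd_base_mem:
  assumes "p \<in> road_space r" "N \<in> road_nbhd_base r p" shows "p \<in> N"
proof (cases p)
  case (Edge x y t)
  then have eq: "Edge x y t = road_point x y t"
    using assms(1) by (auto simp: road_space_def road_point_def split: if_splits)
  obtain a b where "N = road_seg x y {a<..<b}" "a < t" "t < b" using assms(2) Edge by auto
  then show ?thesis unfolding Edge eq by simp
next
  case (Node x)
  then show ?thesis using assms by (auto simp: road_star_def)
qed

lemma edge_nbhd:
  assumes "0 < t" "t < 1" "a < t" "t < b"
    and "\<And>s. 0 < s \<Longrightarrow> s < 1 \<Longrightarrow> a < s \<Longrightarrow> s < b \<Longrightarrow> road_point x y s \<in> U"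
  shows "\<exists>N\<in>road_nbhd_base r (road_point x y t). N \<subseteq> U"
proof -
  have "road_seg x y {max a 0<..<min b 1} \<in> road_nbhd_base r (Edge x y t)"
    using assms by (intro edge_nbhd_baseI) auto
  moreover have "road_seg x y {max a 0<..<min b 1} \<subseteq> U" using assms by auto
  moreover have "road_point x y t = Edge x y t" using assms by (simp add: road_point_def)
  ultimately show ?thesis by metis
qed

lemma road_star_edge_nbhd:
  assumes "q \<in> road_star r x n" "q \<noteq> Node x" "n \<ge> 1" "road_star r x n \<subseteq> U"
  shows "\<exists>N\<in>road_nbhd_base r q. N \<subseteq> U"
proof -
  obtain y s where y: "y \<in> immediate_succs r x" "0 \<le> s" "s < 1 / real n" "q = road_point x y s"
    using assms(1,2) by (auto simp: road_star_def)
  have "1 / real n \<le> 1" using assms(3) by simp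
  moreover have "s \<noteq> 0" using assms(2) y(4) by auto
  ultimately have s: "0 < s" "s < 1" using y by auto
  have "road_point x y u \<in> U" if "0 < u" "u < 1 / real n" for u
  proof -
    have "road_point x y u \<in> road_star r x n"
      using y(1) that unfolding road_star_def by fastforce
    then show ?thesis using assms(4) by blast
  qed
  then show ?thesis
    using edge_nbhd[OF s, of 0 "1 / real n" x y U] s y by blast
qed

lemma road_seg_subset_space:
  assumes "y \<in> immediate_succs r x" "A \<subseteq> {0..1}" shows "road_seg x y A \<subseteq> road_space r"
proof -
  have "x \<in> Field r" using immediate_succs_Field(1)[OF assms(1)] .
  then have "road_seg x y {0..1} \<subseteq> road_space r"
    unfolding road_space_def using assms(1) by (intro le_supI2 SUP_upper2[of x] SUP_upper2[of y]) auto
  then show ?thesis using image_mono[OF assms(2), of "road_point x y"] by (rule order_trans[rotated])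
qed

lemma road_star_subset_space:
  assumes "x \<in> Field r" "n \<ge> 1" shows "road_star r x n \<subseteq> road_space r"
proof -
  have "1 / real n \<le> 1" using assms by simp
  then have "{0..<1 / real n} \<subseteq> {0..1}" by auto
  then have "\<And>y. y \<in> immediate_succs r x \<Longrightarrow> road_seg x y {0..<1 / real n} \<subseteq> road_space r"
    by (rule road_seg_subset_space[rotated])
  moreover have "Node x \<in> road_space r" using assms by (simp add: road_space_def)
  ultimately show ?thesis unfolding road_star_def by blast
qed

lemma openin_road_nbhd_base:
  assumes p: "p \<in> road_space r" and N: "N \<in> road_nbhd_base r p"
  shows "openin (road_topology r) N"
  unfolding openin_road_topology road_open_def
proof (intro conjI ballI)
  have "N \<subseteq> road_space r \<and> (\<forall>q\<in>N. \<exists>M\<in>road_nbhd_base r q. M \<subseteq> N)"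
  proof (cases p)
    case (Edge x y t)
    then have xy: "x \<in> Field r" "y \<in> immediate_succs r x"
      using p by (auto simp: road_space_def road_point_def split: if_splits)
    obtain a b where ab: "N = road_seg x y {a<..<b}" "0 \<le> a" "b \<le> 1" using N Edge by auto
    have "\<exists>M\<in>road_nbhd_base r (road_point x y s). M \<subseteq> N" if "a < s" "s < b" for s
      by (rule edge_nbhd[of s a b]) (use ab that in auto)
    moreover have "N \<subseteq> road_space r" 
      unfolding ab(1) by (intro road_seg_subset_space[OF xy(2)]) (use ab in auto)
    ultimately show ?thesis using ab by auto
  next
    case (Node x)
    have x: "x \<in> Field r"
      using p Node immediate_succs_Field by (auto simp: road_space_def road_point_def split: if_splits)
    from x show ?thesis
    proof (cases rule: point_cases)
      case minimal
      then obtain n where n: "N = road_star r x n" "n \<ge> 1"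
        using N Node not_minimal_succ not_minimal_limit by auto
      show ?thesis
      proof (intro conjI ballI)
        show "N \<subseteq> road_space r" using road_star_subset_space x n by blast
        fix q assume q: "q \<in> N"
        show "\<exists>M\<in>road_nbhd_base r q. M \<subseteq> N"
        proof (cases "q = Node x")
          case True then show ?thesis using N Node by blast
        next
          case False
          with q n show ?thesis by (intro road_star_edge_nbhd[of q x n]) auto
        qed
      qed
    next
      case (succ z0)
      then obtain z n where n: "N = road_star r x n \<union> road_seg z x {1 - 1 / real n<..1}" "n \<ge> 1"
        and z: "x \<in> immediate_succs r z"
        using N Node not_minimal_succ not_succ_limit by auto
      have n1: "0 \<le> 1 - 1 / real n" using n by simp
      show ?thesis
      proof (intro conjI ballI)
        have "road_seg z x {1 - 1 / real n<..1} \<subseteq> road_space r"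
          using n1 by (intro road_seg_subset_space[OF z]) auto
        then show "N \<subseteq> road_space r" using road_star_subset_space x n by blast
        fix q assume q: "q \<in> N"
        show "\<exists>M\<in>road_nbhd_base r q. M \<subseteq> N"
        proof (cases "q = Node x")
          case True then show ?thesis using N Node by blast
        next
          case nx: False
          show ?thesis
          proof (cases "q \<in> road_star r x n")
            case True
            then show ?thesis by (rule road_star_edge_nbhd) (use nx n in auto)
          next
            case False
            then obtain s where s: "q = road_point z x s" "1 - 1 / real n < s" "s \<le> 1"
              using q n by auto
            have "s \<noteq> 1" using nx s by auto
            moreover have "0 < s" using s(2) n1 by linarith
            ultimately show ?thesis
              unfolding s(1)
              by (intro edge_nbhd[of s "1 - 1 / real n" 1]) (use s n in auto)
          qed
        qed
      qed
    next
      case limit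
      let ?I = "\<lambda>z v. {p \<in> road_space r. road_less r (Node z) p \<and> (road_less r p (Node v) \<or> p = Node v)}"
      obtain z n where n: "n \<ge> 1" "z \<in> underS r x"
        and N_eq: "N = ?I z x \<union> (\<Union>w \<in> {w. z \<in> underS r w \<and> (w, x) \<in> r}. road_star r w n)"
      proof -
        have "x \<notin> minimal_points r" "\<And>z. x \<notin> immediate_succs r z"
          using limit not_minimal_limit not_succ_limit by blast+
        then have "\<exists>z n. N = ?I z x \<union> (\<Union>w \<in> {w. z \<in> underS r w \<and> (w, x) \<in> r}. road_star r w n) \<and>
            x \<in> limit_level_points r \<and> z \<in> underS r x \<and> n \<ge> 1"
          using N Node by simp
        then show ?thesis using that by blast
      qed
      have starN: "road_star r w n \<subseteq> N" if "z \<in> underS r w" "(w, x) \<in> r" for w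
        using that N_eq by blast
      have edgeN: "road_point v w s \<in> N"
        if "(z, v) \<in> r" "w \<in> immediate_succs r v" "(w, x) \<in> r" "0 < s" "s < 1" for v w s
      proof -
        have "v \<in> Field r" using immediate_succs_Field(1)[OF that(2)] .
        moreover have "s \<in> {0..1}" using that by auto
        ultimately have "road_point v w s \<in> road_space r" using that(2) unfolding road_space_def by blast
        moreover have "road_point v w s = Edge v w s" using that by (simp add: road_point_def)
        ultimately show ?thesis unfolding N_eq using that by auto
      qed
      show ?thesis
      proof (intro conjI ballI)
        show "N \<subseteq> road_space r"
        proof -
          have "road_star r w n \<subseteq> road_space r" if "z \<in> underS r w" for w
            using road_star_subset_space[OF underS_Field2[OF that] n(1)] .
          then show ?thesis unfolding N_eq by blast
        qed
        fix q assume q: "q \<in> N"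
        show "\<exists>M\<in>road_nbhd_base r q. M \<subseteq> N"
        proof (cases "\<exists>w. q \<in> road_star r w n \<and> q \<noteq> Node w \<and> z \<in> underS r w \<and> (w, x) \<in> r")
          case True
          then obtain w where "q \<in> road_star r w n" "q \<noteq> Node w" "z \<in> underS r w" "(w, x) \<in> r"
            by blast
          then show ?thesis using n(1) by (intro road_star_edge_nbhd[of q w n] starN)
        next
          case no_star: False
          show ?thesis
          proof (cases q)
            case (Edge v w s)
            then have "q \<in> ?I z x" using q no_star unfolding N_eq by blast
            then have *: "(z, v) \<in> r" "w \<in> immediate_succs r v" "(w, x) \<in> r" "0 < s" "s < 1"
              using Edge by (auto simp: road_space_def road_point_def split: if_splits)
            then have "q = road_point v w s" using Edge by (simp add: road_point_def)
            then show ?thesis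
              using edge_nbhd[of s 0 1 v w N] edgeN * by simp
          next
            case v: (Node v)
            have v': "z \<in> underS r v" "(v, x) \<in> r"
            proof -
              have "q \<in> ?I z x \<or> (z \<in> underS r v \<and> (v, x) \<in> r)"
                using q no_star v unfolding N_eq by blast
              then show "z \<in> underS r v" "(v, x) \<in> r"
                using v tree_refl[OF x] by (auto simp: underS_def)
            qed
            have "v \<in> Field r" using underS_Field2[OF v'(1)] .
            then show ?thesis
            proof (cases rule: point_cases)
              case minimal then show ?thesis using v' by (auto simp: minimal_points_def)
            next
              case (succ u)
              have zu: "(z, u) \<in> r" using immediate_pred_le[OF succ v'(1)] .
              have "1 - 1 / real n \<ge> 0" using n by simp
              have "road_point u v s \<in> N" if "1 - 1 / real n < s" "s \<le> 1" for s
              proof (cases "s = 1")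
                case True then show ?thesis using q v by simp
              next
                case False
                then show ?thesis using edgeN[OF zu succ v'(2), of s] that \<open>1 - 1 / real n \<ge> 0\<close> by simp
              qed
              then have "road_star r v n \<union> road_seg u v {1 - 1 / real n<..1} \<subseteq> N"
                using starN v' by auto
              moreover have "road_star r v n \<union> road_seg u v {1 - 1 / real n<..1} \<in> road_nbhd_base r q"
                using succ_nbhd_baseI[OF succ n(1)] v by simp
              ultimately show ?thesis by blast
            next
              case limit
              let ?M = "?I z v \<union> (\<Union>w \<in> {w. z \<in> underS r w \<and> (w, v) \<in> r}. road_star r w n)"
              have "road_less r e (Node x) \<or> e = Node x" if "road_less r e (Node v) \<or> e = Node v" for e
              proof (cases e)
                case (Node w)
                then show ?thesis
                  using that tree_trans[OF _ v'(2), of w] v'(2) by (auto simp: underS_def)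
              next
                case (Edge a b t)
                then show ?thesis using that tree_trans[OF _ v'(2)] by auto
              qed
              moreover have "(w, v) \<in> r \<Longrightarrow> (w, x) \<in> r" for w using tree_trans[OF _ v'(2)] .
              ultimately have "?I z v \<subseteq> ?I z x" "{w. z \<in> underS r w \<and> (w, v) \<in> r} \<subseteq> {w. z \<in> underS r w \<and> (w, x) \<in> r}"
                by auto
              then have "?M \<subseteq> N" unfolding N_eq by (intro Un_mono UN_mono) auto
              moreover have "?M \<in> road_nbhd_base r q" using limit_nbhd_baseI[OF limit v'(1) n(1)] v by simp
              ultimately show ?thesis by blast
            qed
          qed
        qed
      qed
    qed
  qed
  then show "N \<subseteq> road_space r" "\<And>q. q \<in> N \<Longrightarrow> \<exists>M\<in>road_nbhd_base r q. M \<subseteq> N" by auto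
qed

lemma topspace_road_topology: "topspace (road_topology r) = road_space r"
proof
  show "topspace (road_topology r) \<subseteq> road_space r"
    using openin_topspace[of "road_topology r"] unfolding openin_road_topology road_open_def by blast
  show "road_space r \<subseteq> topspace (road_topology r)"
  proof
    fix p assume p: "p \<in> road_space r"
    have "\<exists>N. N \<in> road_nbhd_base r p"
    proof (cases p)
      case (Edge x y t)
      then have "0 < t" "t < 1" using p by (auto simp: road_space_def road_point_def split: if_splits)
      then have "road_seg x y {0<..<1} \<in> road_nbhd_base r p"
        using Edge edge_nbhd_baseI[of 0 t 1] by simp
      then show ?thesis by blast
    next
      case (Node x)
      then have "x \<in> Field r"
        using p immediate_succs_Field by (auto simp: road_space_def road_point_def split: if_splits)
      then show ?thesis
      proof (cases rule: point_cases)
        case minimal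
        then have "road_star r x 1 \<in> road_nbhd_base r p" using Node by auto
        then show ?thesis by blast
      next
        case (succ z)
        then have "road_star r x 1 \<union> road_seg z x {1 - 1 / real 1<..1} \<in> road_nbhd_base r p"
          using succ_nbhd_baseI[OF succ, of 1] Node by simp
        then show ?thesis by blast
      next
        case limit
        then obtain z where "z \<in> underS r x" by (auto simp: limit_level_points_def)
        then show ?thesis using limit_nbhd_baseI[OF limit, of z 1] unfolding Node by blast
      qed
    qed
    then obtain N where N: "N \<in> road_nbhd_base r p" by blast
    show "p \<in> topspace (road_topology r)"
      using openin_subset[OF openin_road_nbhd_base[OF p N]] road_nbhd_base_mem[OF p N] by blast
  qed
qed

end

end

theory Submission
  imports Defs "HOL-Library.Countable_Set_Type"
begin

text \<open>Call \<open>x \<in> S\<close> good if it reflects, for every rational time \<open>q\<close>, the question which later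
  points of \<open>S\<close> are still above a given \<open>z < x\<close> at time \<open>q\<close> of the contraction \<open>h\<close>. If a good \<open>x\<close> has
  left the cone above it at time \<open>q\<close>, then every later point of \<open>S\<close> has, at that same time, left the
  cone above a common \<open>z < x\<close>. The set of times at which \<open>x\<close> is outside its own cone can thus only
  grow along good points, and a second use of stationarity makes it (at rational times) the same
  for two good points \<open>x < s\<close>. At its infimum, \<open>s\<close> is still above itself, hence strictly above \<open>x\<close>;
  but shortly after it has to be outside the cone above \<open>x\<close>, which contradicts continuity.\<close>

section \<open>Order combinatorics of trees: thin sets and stationarity\<close>

definition min_els :: "'a rel \<Rightarrow> 'a set \<Rightarrow> 'a set" where
  "min_els r B = {b \<in> B. underS r b \<inter> B = {}}"

text \<open>For \<open>S\<close> inside the field this is closed discreteness of \<open>D\<close> in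
  the subspace \<open>S\<close>, expressed by the neighbourhoods (z, x]; minimal points are
  isolated, hence exempt. See \<open>thin_in_iff_closed_discrete\<close>.\<close>

definition thin_in :: "'a rel \<Rightarrow> 'a set \<Rightarrow> 'a set \<Rightarrow> bool" where
  "thin_in r S D \<longleftrightarrow> D \<subseteq> S \<and> (\<forall>x\<in>S. x \<notin> minimal_points r \<longrightarrow>
     (\<exists>z\<in>underS r x. \<forall>d\<in>D. z \<in> underS r d \<longrightarrow> (d, x) \<in> r \<longrightarrow> d = x))"

definition thin_sets_countable :: "'a rel \<Rightarrow> 'a set \<Rightarrow> bool" where
  "thin_sets_countable r S \<longleftrightarrow> (\<forall>D. thin_in r S D \<longrightarrow> countable D)"

text \<open>Countable sets closed under an operation replace countable elementary submodels: the
  first point outside such a set on the way up to a given point behaves like a point on a level of a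
  club.\<close>

lemma countable_closure_exists:
  assumes "countable A" "\<And>z. countable (G z)"
  obtains M where "countable M" "A \<subseteq> M" "\<And>z. z \<in> M \<Longrightarrow> G z \<subseteq> M"
proof -
  define f where "f = (\<lambda>A. \<Union>z\<in>A. G z)"
  have "countable ((f ^^ n) A)" for n
    by (induction n) (auto simp: f_def assms)
  moreover have "G z \<subseteq> (f ^^ Suc n) A" if "z \<in> (f ^^ n) A" for z n
    using that by (auto simp: f_def)
  moreover have "A \<subseteq> (\<Union>n. (f ^^ n) A)" by (rule SUP_upper2[of 0]) auto
  ultimately show ?thesis by (intro that[of "\<Union>n. (f ^^ n) A"]) blast+
qed

context
  fixes r :: "'a rel"
  assumes tree: "is_tree r"
begin

lemma underS_le: "x \<in> underS r y \<Longrightarrow> (x, y) \<in> r"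
  and underS_not_ge: "x \<in> underS r y \<Longrightarrow> (y, x) \<notin> r"
  by (auto simp: underS_def dest: tree_antisym[OF tree])

lemma le_cases: "(x, y) \<in> r \<Longrightarrow> x = y \<or> x \<in> underS r y"
  by (auto simp: underS_def)

lemma le_comparable:
  assumes "(x, s) \<in> r" "(y, s) \<in> r"
  shows "(x, y) \<in> r \<or> y \<in> underS r x"
proof -
  have "(x, x) \<in> r" "(y, y) \<in> r" using assms tree_refl[OF tree] by (auto simp: Field_def)
  then show ?thesis
    using le_cases[OF assms(1)] le_cases[OF assms(2)] tree_comparable[OF tree, of x s y] assms
      underS_le by blast
qed

lemma min_els_below:
  assumes "b \<in> B"
    and "b \<in> Field r"
  obtains a where "a \<in> min_els r B" "(a, b) \<in> r"
proof (cases "underS r b \<inter> B = {}")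
  case True
  then show ?thesis using that[of b] assms tree_refl[OF tree] by (auto simp: min_els_def)
next
  case False
  have "well_order_on (underS r b) (Restr r (underS r b))"
    using tree assms by (auto simp: is_tree_def)
  then have "wf (Restr r (underS r b) - Id)" by (simp add: well_order_on_def)
  then obtain a where a: "a \<in> underS r b \<inter> B"
    "\<And>y. (y, a) \<in> Restr r (underS r b) - Id \<Longrightarrow> y \<notin> underS r b \<inter> B"
    using wfE_min'[of _ "underS r b \<inter> B"] False by metis
  have "y \<notin> B" if "y \<in> underS r a" for y
  proof -
    have "y \<in> underS r b" using that a underS_trans[OF tree] underS_le by blast
    then show ?thesis using a(2)[of y] that a(1) by (auto simp: underS_def)
  qed
  then have "a \<in> min_els r B" using a by (auto simp: min_els_def)
  then show ?thesis using that a underS_le by blast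
qed

text \<open>If some \<open>e\<close> in \<open>A\<close> is below x, then z = e works, since all of
  (e, x] is above \<open>e\<close> and so misses \<open>A\<close>. Otherwise any predecessor z of x
  works, since (z, x] can meet \<open>A\<close> only in x.\<close>

lemma thin_in_antichain:
  assumes "A \<subseteq> S" and "\<And>x y. x \<in> A \<Longrightarrow> y \<in> A \<Longrightarrow> x \<notin> underS r y" and "S \<subseteq> Field r"
  shows "thin_in r S A"
  unfolding thin_in_def
proof (intro conjI ballI impI)
  fix x assume x: "x \<in> S" "x \<notin> minimal_points r"
  show "\<exists>z\<in>underS r x. \<forall>d\<in>A. z \<in> underS r d \<longrightarrow> (d, x) \<in> r \<longrightarrow> d = x"
  proof (cases "\<exists>e\<in>A. e \<in> underS r x")
    case True
    then show ?thesis using assms(2) by blast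
  next
    case False
    moreover have "underS r x \<noteq> {}" using x assms by (auto simp: minimal_points_def)
    ultimately show ?thesis using le_cases by blast
  qed
qed fact

lemma countable_min_els:
  assumes "thin_sets_countable r S" "B \<subseteq> S" "S \<subseteq> Field r"
  shows "countable (min_els r B)"
proof -
  have "thin_in r S (min_els r B)"
    using assms(2,3) by (intro thin_in_antichain) (auto simp: min_els_def)
  then show ?thesis using assms(1) by (simp add: thin_sets_countable_def)
qed

text \<open>No point of the cone lies below a point outside it, so a thin subset of the cone is thin
  in \<open>S\<close>. This permits a second application of stationarity above a chosen
  point.\<close>

lemma thin_sets_countable_cone:
  assumes "thin_sets_countable r S" "S \<subseteq> Field r"
  shows "thin_sets_countable r {s \<in> S. (x, s) \<in> r}"
  unfolding thin_sets_countable_def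
proof (intro allI impI)
  fix D assume D: "thin_in r {s \<in> S. (x, s) \<in> r} D"
  have "thin_in r S D"
    unfolding thin_in_def
  proof (intro conjI ballI impI)
    show "D \<subseteq> S" using D by (auto simp: thin_in_def)
    fix y assume y: "y \<in> S" "y \<notin> minimal_points r"
    show "\<exists>z\<in>underS r y. \<forall>d\<in>D. z \<in> underS r d \<longrightarrow> (d, y) \<in> r \<longrightarrow> d = y"
    proof (cases "(x, y) \<in> r")
      case True
      then show ?thesis using D y by (auto simp: thin_in_def)
    next
      case False
      have "(d, y) \<notin> r" if "d \<in> D" for d
        using that D False tree_trans[OF tree, of x d y] by (auto simp: thin_in_def)
      moreover have "underS r y \<noteq> {}" using y assms by (auto simp: minimal_points_def)
      ultimately show ?thesis by blast
    qed
  qed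
  then show "countable D" using assms(1) by (simp add: thin_sets_countable_def)
qed

text \<open>A form of stationarity that avoids ordinals: the points \<open>x\<close> in question play the role of
  the levels in the club of ordinals closed under \<open>F\<close>.\<close>

lemma stationary:
  fixes F :: "'a \<Rightarrow> 'a set"
  assumes S: "S \<subseteq> Field r" "uncountable S" "thin_sets_countable r S"
    and preds: "\<And>x. countable (underS r x)" and F: "\<And>z. countable (F z)"
  shows "\<exists>x\<in>S. x \<in> limit_level_points r \<and> (\<forall>z\<in>underS r x. \<forall>y\<in>F z. (x, y) \<notin> r)"
proof (rule ccontr)
  assume no: "\<not> ?thesis"
  define C where "C = {x \<in> limit_level_points r. \<forall>z\<in>underS r x. \<forall>y\<in>F z. (x, y) \<notin> r}"
  have SC: "x \<notin> C" if "x \<in> S" for x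
    using that no unfolding C_def by blast
  \<comment> \<open>\<open>gap s x\<close> says that (s, x] misses \<open>C\<close>. The set
    \<open>D\<close> below consists of the points of \<open>S\<close> that \<open>C\<close>
    separates from every earlier point of \<open>S\<close>; roughly, the first points of
    \<open>S\<close> in the gaps of \<open>C\<close>.\<close>
  define gap where "gap = (\<lambda>s x. \<forall>c\<in>C. \<not> (s \<in> underS r c \<and> (c, x) \<in> r))"
  define D where "D = {x \<in> S. \<forall>s\<in>S. s \<in> underS r x \<longrightarrow> \<not> gap s x}"
  have "thin_in r S D"
    unfolding thin_in_def
  proof (intro conjI ballI impI)
    show "D \<subseteq> S" by (auto simp: D_def)
    fix x assume x: "x \<in> S" "x \<notin> minimal_points r"
    \<comment> \<open>\<open>C\<close> is closed and misses x. At a successor, (z, x] is just {x}.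
      At a limit, some y in \<open>F z\<close> with z < x \<le> y keeps x out of \<open>C\<close>,
      and the same y keeps out every point of (z, x].\<close>
    have "\<exists>z\<in>underS r x. gap z x"
    proof -
      have "x \<in> Field r" using x S by blast
      then show ?thesis
      proof (cases rule: point_cases[OF tree, consumes 1, case_names minimal succ limit])
        case minimal then show ?thesis using x by blast
      next
        case (succ z)
        then have z: "z \<in> underS r x" "\<And>c. z \<in> underS r c \<Longrightarrow> c \<notin> underS r x"
          by (auto simp: immediate_succs_def)
        then have "gap z x" using SC[OF x(1)] le_cases unfolding gap_def by blast
        then show ?thesis using z by blast
      next
        case limit
        then obtain z y where zy: "z \<in> underS r x" "y \<in> F z" "(x, y) \<in> r"
          using SC[OF x(1)] unfolding C_def by blast
        then have "gap z x" unfolding gap_def C_def using tree_trans[OF tree] by blast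
        then show ?thesis using zy by blast
      qed
    qed
    then obtain z where z: "z \<in> underS r x" "gap z x" by blast
    show "\<exists>z\<in>underS r x. \<forall>d\<in>D. z \<in> underS r d \<longrightarrow> (d, x) \<in> r \<longrightarrow> d = x"
    proof (cases "\<exists>e\<in>D. z \<in> underS r e \<and> e \<in> underS r x")
      case True
      \<comment> \<open>Raise the lower endpoint to \<open>e\<close>: a further point d of
        \<open>D\<close> in (e, x] would have \<open>gap e d\<close>, against the definition of
        \<open>D\<close>.\<close>
      then obtain e where e: "e \<in> D" "z \<in> underS r e" "e \<in> underS r x" by blast
      have "\<not> (e \<in> underS r d \<and> (d, x) \<in> r)" if "d \<in> D" for d
      proof
        assume d: "e \<in> underS r d \<and> (d, x) \<in> r"
        then have "gap e d"
          using z(2) e(2) tree_trans[OF tree] underS_trans[OF tree] underS_le unfolding gap_def by blast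
        then show False using d that e(1) by (auto simp: D_def)
      qed
      then show ?thesis using e(3) by blast
    next
      case False
      then show ?thesis using z(1) le_cases by blast
    qed
  qed
  then have "countable D" using S(3) by (simp add: thin_sets_countable_def)
  have "\<exists>d\<in>D. (d, s) \<in> r \<and> gap d s" if s: "s \<in> S" for s
  proof -
    \<comment> \<open>A minimal element of \<open>B\<close> is the start of the gap containing
      \<open>s\<close>: an earlier point of \<open>S\<close> in the same gap would belong to
      \<open>B\<close> too.\<close>
    define B where "B = {u \<in> S. (u, s) \<in> r \<and> gap u s}"
    have "s \<in> Field r" using s S by blast
    moreover have "s \<in> B" using s tree_refl[OF tree calculation] underS_not_ge by (auto simp: B_def gap_def)
    ultimately obtain a where a: "a \<in> min_els r B" using min_els_below by metis
    have "\<not> gap u a" if u: "u \<in> S" "u \<in> underS r a" for u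
    proof
      assume gap: "gap u a"
      have as: "(a, s) \<in> r" "gap a s" "u \<notin> B" using a u by (auto simp: min_els_def B_def)
      have "gap u s"
        unfolding gap_def
      proof (intro ballI notI)
        fix c assume c: "c \<in> C" "u \<in> underS r c \<and> (c, s) \<in> r"
        then have "(c, a) \<in> r \<or> a \<in> underS r c" using le_comparable as by blast
        then show False using c gap as(2) unfolding gap_def by blast
      qed
      then show False using as u underS_le tree_trans[OF tree] unfolding B_def by blast
    qed
    then have "a \<in> D" using a by (auto simp: D_def min_els_def B_def)
    then show ?thesis using a by (auto simp: min_els_def B_def)
  qed
  \<comment> \<open>Countably many gaps cover \<open>S\<close>, so one of them contains uncountably
    many points of \<open>S\<close>. The rest shows that \<open>C\<close> is unbounded: it meets (d,
    s] for some \<open>s\<close> in that gap.\<close>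
  then have "S \<subseteq> (\<Union>d\<in>D. {s \<in> S. (d, s) \<in> r \<and> gap d s})" by blast
  then obtain d where d: "d \<in> D" "uncountable {s \<in> S. (d, s) \<in> r \<and> gap d s}"
    using S(2) \<open>countable D\<close> countable_subset countable_UN by (metis (no_types, lifting))
  define G where "G = (\<lambda>z. F z \<union> min_els r {s \<in> S. z \<in> underS r s} \<union> underS r z)"
  have "countable (G z)" for z
    unfolding G_def using F preds countable_min_els[OF S(3) _ S(1)] by auto
  then obtain M where M: "countable M" "{d} \<subseteq> M" "\<And>z. z \<in> M \<Longrightarrow> G z \<subseteq> M"
    using countable_closure_exists[of "{d}" G] by (metis countable_empty countable_insert)
  have down: "x \<in> M" if "(x, y) \<in> r" "y \<in> M" for x y
    using le_cases[OF that(1)] M(3)[OF that(2)] that(2) unfolding G_def by blast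
  obtain s where s: "s \<in> S" "(d, s) \<in> r" "gap d s" "s \<notin> M"
    using d(2) M(1) countable_subset[OF _ M(1), of "{s \<in> S. (d, s) \<in> r \<and> gap d s}"] by blast
  have "s \<in> Field r" using s S by blast
  \<comment> \<open>Take the first point not in \<open>M\<close> on the way up to \<open>s\<close>.
    All its predecessors are in \<open>M\<close>, so closure of \<open>M\<close> under
    \<open>F\<close>, together with downward closure, keeps x from being below any point of
    \<open>F z\<close> with z < x.\<close>
  then obtain x where x: "x \<in> min_els r {y. (y, s) \<in> r \<and> y \<notin> M}"
    using min_els_below[of s "{y. (y, s) \<in> r \<and> y \<notin> M}"] s(4) tree_refl[OF tree] by blast
  then have x': "(x, s) \<in> r" "x \<notin> M" "\<And>z. z \<in> underS r x \<Longrightarrow> z \<in> M"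
    using underS_le tree_trans[OF tree] by (auto simp: min_els_def) blast
  have dx: "d \<in> underS r x" using le_comparable[OF x'(1) s(2)] down x'(2) M(2) by blast
  have "x \<in> limit_level_points r"
  proof -
    have "x \<in> Field r" using underS_Field2[OF dx] .
    then show ?thesis
    proof (cases rule: point_cases[OF tree, consumes 1, case_names minimal succ limit])
      case minimal then show ?thesis using dx by (auto simp: minimal_points_def)
    next
      case (succ z)
      then have z: "z \<in> underS r x" "\<And>c. z \<in> underS r c \<Longrightarrow> c \<notin> underS r x"
        by (auto simp: immediate_succs_def)
      \<comment> \<open>If x were the successor of z, the first point of \<open>S\<close> above z on
        the way to \<open>s\<close> would be in \<open>M\<close> and at or above x, forcing x into
        \<open>M\<close>.\<close>
      then have "s \<in> {s \<in> S. z \<in> underS r s}" using s x' underS_trans[OF tree] by blast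
      then obtain a where a: "a \<in> min_els r {s \<in> S. z \<in> underS r s}" "(a, s) \<in> r"
        by (rule min_els_below[OF _ \<open>s \<in> Field r\<close>])
      then have "a \<in> M" "z \<in> underS r a"
        using M(3)[OF x'(3)[OF z(1)]] by (auto simp: G_def min_els_def)
      then show ?thesis using le_comparable[OF x'(1) a(2)] down x'(2) z(2) by blast
    qed
  qed
  moreover have "(x, y) \<notin> r" if "z \<in> underS r x" "y \<in> F z" for z y
    using M(3)[OF x'(3)[OF that(1)]] that(2) down x'(2) unfolding G_def by blast
  ultimately have "x \<in> C" by (auto simp: C_def)
  then show False using s(3) dx x'(1) by (auto simp: gap_def)
qed

text \<open>The Suslin case. Let \<open>M\<close> be countable, downward closed, contain the minimal
  points of \<open>D\<close> and, for z in \<open>M\<close>, the minimal points of \<open>D\<close>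
  above z. If some d in \<open>D\<close> is outside \<open>M\<close>, let x be the first point
  outside \<open>M\<close> up to d. Thinness at x gives z < x such that (z, x] meets
  \<open>D\<close> at most in x; but the first point of \<open>D\<close> above z below d is in
  \<open>M\<close>, hence strictly between z and x.\<close>

lemma thin_sets_countable_if_countable_antichains:
  assumes preds: "\<And>x. countable (underS r x)"
    and anti: "\<And>A. antichain r A \<Longrightarrow> countable A"
  shows "thin_sets_countable r (Field r)"
  unfolding thin_sets_countable_def
proof (intro allI impI)
  fix D assume D: "thin_in r (Field r) D"
  have min: "countable (min_els r B)" if "B \<subseteq> D" for B
    using that D by (intro anti) (auto simp: antichain_def min_els_def thin_in_def dest: le_cases)
  define G where "G = (\<lambda>z. min_els r {s \<in> D. z \<in> underS r s} \<union> underS r z)"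
  have "countable (G z)" for z
    unfolding G_def using preds min by auto
  then obtain M where M: "countable M" "min_els r D \<subseteq> M" "\<And>z. z \<in> M \<Longrightarrow> G z \<subseteq> M"
    using countable_closure_exists[of "min_els r D" G] min by (metis order_refl)
  have down: "x \<in> M" if "(x, y) \<in> r" "y \<in> M" for x y
    using le_cases[OF that(1)] M(3)[OF that(2)] that(2) unfolding G_def by blast
  have "D \<subseteq> M"
  proof
    fix d assume d: "d \<in> D"
    show "d \<in> M"
    proof (rule ccontr)
      assume "d \<notin> M"
      have dF: "d \<in> Field r" using d D by (auto simp: thin_in_def)
      then obtain x where x: "x \<in> min_els r {y. (y, d) \<in> r \<and> y \<notin> M}"
        using min_els_below[of d "{y. (y, d) \<in> r \<and> y \<notin> M}"] \<open>d \<notin> M\<close> tree_refl[OF tree] by blast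
      then have x': "(x, d) \<in> r" "x \<notin> M" "\<And>z. z \<in> underS r x \<Longrightarrow> z \<in> M"
        using underS_le tree_trans[OF tree] by (auto simp: min_els_def) blast
      obtain a where a: "a \<in> min_els r D" "(a, d) \<in> r" using min_els_below[OF d dF] by blast
      then have "a \<in> underS r x" using le_comparable[OF x'(1)] down M(2) x'(2) by blast
      then have "x \<in> Field r" "x \<notin> minimal_points r"
        using underS_Field2 by (auto simp: minimal_points_def)
      then obtain z where z: "z \<in> underS r x" "\<And>e. e \<in> D \<Longrightarrow> z \<in> underS r e \<Longrightarrow> (e, x) \<in> r \<Longrightarrow> e = x"
        using D unfolding thin_in_def by blast
      have "d \<in> {s \<in> D. z \<in> underS r s}" using d underS_trans[OF tree] z x'(1) by blast
      then obtain b where b: "b \<in> min_els r {s \<in> D. z \<in> underS r s}" "(b, d) \<in> r"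
        by (rule min_els_below[OF _ dF])
      have "b \<in> M" using b M(3)[OF x'(3)[OF z(1)]] by (auto simp: G_def)
      moreover from this have "b \<in> underS r x"
        using le_comparable[OF x'(1) b(2)] down x'(2) by blast
      ultimately show False using z(2)[of b] b x'(2) underS_le by (auto simp: min_els_def)
    qed
  qed
  then show "countable D" using M(1) countable_subset by blast
qed

section \<open>The interval topology and the meaning of thin sets\<close>

lemma tree_topology_nbhd:
  assumes "openin (tree_topology r) U" "x \<in> U" "x \<notin> minimal_points r"
  shows "\<exists>z\<in>underS r x. \<forall>y. z \<in> underS r y \<longrightarrow> (y, x) \<in> r \<longrightarrow> y \<in> U"
proof -
  have "generate_topology_on ({{y. z \<in> underS r y \<and> (y, x) \<in> r} | z x. z \<in> underS r x}
      \<union> {{x} | x. x \<in> minimal_points r}) U"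
    using assms(1) by (simp add: tree_topology_def openin_topology_generated_by_iff)
  then have "\<forall>x\<in>U - minimal_points r. \<exists>z\<in>underS r x. \<forall>y. z \<in> underS r y \<longrightarrow> (y, x) \<in> r \<longrightarrow> y \<in> U"
  proof induction
    case (Int A B)
    show ?case
    proof
      fix x assume x: "x \<in> A \<inter> B - minimal_points r"
      then obtain z z' where z: "z \<in> underS r x" "\<forall>y. z \<in> underS r y \<longrightarrow> (y, x) \<in> r \<longrightarrow> y \<in> A"
        "z' \<in> underS r x" "\<forall>y. z' \<in> underS r y \<longrightarrow> (y, x) \<in> r \<longrightarrow> y \<in> B"
        using Int by blast
      \<comment> \<open>For an intersection the larger of the two lower endpoints serves both
        sets.\<close>
      have "(z, z') \<in> r \<or> z' \<in> underS r z" using le_comparable z underS_le by blast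
      then show "\<exists>z\<in>underS r x. \<forall>y. z \<in> underS r y \<longrightarrow> (y, x) \<in> r \<longrightarrow> y \<in> A \<inter> B"
      proof
        assume "(z, z') \<in> r"
        then show ?thesis using z underS_trans'[OF tree] by (intro bexI[of _ z']) auto
      next
        assume "z' \<in> underS r z"
        then have "(z', z) \<in> r" by (rule underS_le)
        then show ?thesis using z underS_trans'[OF tree] by (intro bexI[of _ z]) auto
      qed
    qed
  next
    case (UN K) then show ?case by blast
  next
    case (Basis s)
    then show ?case
    proof
      assume "s \<in> {{y. z \<in> underS r y \<and> (y, x) \<in> r} | z x. z \<in> underS r x}"
      then show ?thesis using tree_trans[OF tree] by blast
    qed auto
  qed auto
  then show ?thesis using assms by blast
qed

lemma openin_tree_topology_interval:
  "z \<in> underS r x \<Longrightarrow> openin (tree_topology r) {y. z \<in> underS r y \<and> (y, x) \<in> r}"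
  unfolding tree_topology_def by (rule topology_generated_by_Basis) blast

lemma openin_tree_topology_minimal:
  "x \<in> minimal_points r \<Longrightarrow> openin (tree_topology r) {x}"
  unfolding tree_topology_def by (rule topology_generated_by_Basis) blast

lemma topspace_tree_topology: "topspace (tree_topology r) = Field r"
proof
  have "\<Union> ({{y. z \<in> underS r y \<and> (y, x) \<in> r} | z x. z \<in> underS r x}
      \<union> {{x} | x. x \<in> minimal_points r}) \<subseteq> Field r"
    using underS_Field2 by (fastforce simp: minimal_points_def)
  then show "topspace (tree_topology r) \<subseteq> Field r"
    by (simp add: tree_topology_def topology_generated_by_topspace)
  show "Field r \<subseteq> topspace (tree_topology r)"
  proof
    fix x assume x: "x \<in> Field r"
    show "x \<in> topspace (tree_topology r)"
    proof (cases "x \<in> minimal_points r")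
      case True
      then show ?thesis using openin_subset[OF openin_tree_topology_minimal] by blast
    next
      case False
      then obtain z where "z \<in> underS r x" using x by (auto simp: minimal_points_def)
      then show ?thesis
        using openin_subset[OF openin_tree_topology_interval] tree_refl[OF tree x] by blast
    qed
  qed
qed

text \<open>Both sides say that \<open>D\<close> is a subset of \<open>S\<close> without
  accumulation points in \<open>S\<close>: closed means that the derived set lies in
  \<open>D\<close>, discrete that it is disjoint from \<open>D\<close>.\<close>

lemma thin_in_iff_closed_discrete:
  assumes S: "S \<subseteq> Field r"
  shows "thin_in r S D \<longleftrightarrow> closedin (subtopology (tree_topology r) S) D \<and>
    subtopology (subtopology (tree_topology r) S) D = discrete_topology D" (is "_ \<longleftrightarrow> ?rhs")
proof -
  let ?X = "subtopology (tree_topology r) S"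
  have top: "topspace ?X = S" using S by (auto simp: topspace_tree_topology)
  have key: "thin_in r S D \<longleftrightarrow> D \<subseteq> S \<and> (\<forall>x\<in>S. \<exists>U. openin (tree_topology r) U \<and> x \<in> U \<and> U \<inter> D \<subseteq> {x})"
    (is "_ \<longleftrightarrow> _ \<and> ?sep")
  proof
    assume th: "thin_in r S D"
    have "\<exists>U. openin (tree_topology r) U \<and> x \<in> U \<and> U \<inter> D \<subseteq> {x}" if x: "x \<in> S" for x
    proof (cases "x \<in> minimal_points r")
      case True
      then show ?thesis using openin_tree_topology_minimal by blast
    next
      case False
      then obtain z where z: "z \<in> underS r x" "\<forall>d\<in>D. z \<in> underS r d \<longrightarrow> (d, x) \<in> r \<longrightarrow> d = x"
        using th x unfolding thin_in_def by blast
      have "(x, x) \<in> r" using tree_refl[OF tree] x S by blast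
      then show ?thesis using openin_tree_topology_interval[OF z(1)] z by blast
    qed
    then show "D \<subseteq> S \<and> ?sep" using th by (auto simp: thin_in_def)
  next
    assume sep: "D \<subseteq> S \<and> ?sep"
    have "\<exists>z\<in>underS r x. \<forall>d\<in>D. z \<in> underS r d \<longrightarrow> (d, x) \<in> r \<longrightarrow> d = x"
      if x: "x \<in> S" "x \<notin> minimal_points r" for x
    proof -
      obtain U where U: "openin (tree_topology r) U" "x \<in> U" "U \<inter> D \<subseteq> {x}" using sep x by blast
      show ?thesis using tree_topology_nbhd[OF U(1,2) x(2)] U(3) by blast
    qed
    then show "thin_in r S D" using sep by (auto simp: thin_in_def)
  qed
  also have "\<dots> \<longleftrightarrow> D \<subseteq> topspace ?X \<and> ?X derived_set_of D = {}"
  proof (cases "D \<subseteq> S")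
    case True
    have "x \<notin> ?X derived_set_of D \<longleftrightarrow> (\<exists>U. openin (tree_topology r) U \<and> x \<in> U \<and> U \<inter> D \<subseteq> {x})"
      if "x \<in> S" for x
    proof -
      have "x \<in> Field r" using that S by blast
      then have "x \<notin> ?X derived_set_of D \<longleftrightarrow>
          \<not> (\<forall>U. x \<in> U \<and> openin (tree_topology r) U \<longrightarrow> (\<exists>y\<noteq>x. y \<in> D \<and> y \<in> U))"
        using that by (simp add: derived_set_of_subtopology in_derived_set_of topspace_tree_topology
          Int_absorb1[OF True])
      then show ?thesis by blast
    qed
    moreover have "?X derived_set_of D \<subseteq> S" using derived_set_of_subset_topspace top by metis
    ultimately show ?thesis using True top by blast
  qed (simp add: top)
  also have "\<dots> \<longleftrightarrow> ?rhs"
    unfolding closedin_contains_derived_set subtopology_eq_discrete_topology_eq by blast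
  finally show ?thesis .
qed

lemma omega1_compact_iff_thin_sets_countable:
  assumes "S \<subseteq> Field r"
  shows "omega1_compact_space (subtopology (tree_topology r) S) \<longleftrightarrow> thin_sets_countable r S"
  using thin_in_iff_closed_discrete[OF assms]
  by (simp add: omega1_compact_space_def thin_sets_countable_def)

end

section \<open>Cones in the road space\<close>

fun road_base :: "'a road \<Rightarrow> 'a" where
  "road_base (Node x) = x"
| "road_base (Edge x y t) = x"

text \<open>This is the set of all points p \<ge> z of the road space. The interior of the edge
  leading up to z has its base strictly below z and is thus left out.\<close>

definition road_cone :: "'a rel \<Rightarrow> 'a \<Rightarrow> 'a road set" where
  "road_cone r z = {p \<in> road_space r. (z, road_base p) \<in> r}"

lemma road_base_point: "t < 1 \<Longrightarrow> road_base (road_point x y t) = x"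
  by (simp add: road_point_def)

lemma road_base_star: "n \<ge> 1 \<Longrightarrow> p \<in> road_star r x n \<Longrightarrow> road_base p = x"
proof -
  assume n: "n \<ge> 1" and p: "p \<in> road_star r x n"
  have "1 / real n \<le> 1" using n by simp
  then have "\<And>t. t < 1 / real n \<Longrightarrow> t < 1" by linarith
  then show ?thesis using p by (auto simp: road_star_def road_base_point)
qed

context
  fixes r :: "'a rel"
  assumes tree: "is_tree r"
begin

lemma Node_in_road_space_iff: "Node x \<in> road_space r \<longleftrightarrow> x \<in> Field r"
  using immediate_succs_Field by (fastforce simp: road_space_def road_point_def split: if_splits)

lemma road_cone_mono: "(z, w) \<in> r \<Longrightarrow> road_cone r w \<subseteq> road_cone r z"
  using tree_trans[OF tree] by (auto simp: road_cone_def)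

lemma road_base_Field: "p \<in> road_space r \<Longrightarrow> road_base p \<in> Field r"
  using immediate_succs_Field by (fastforce simp: road_space_def road_point_def split: if_splits)

text \<open>A small neighbourhood climbs only into outgoing edges, whose interior points keep their
  lower end as base, and never reaches a higher node. Hence cones are closed.\<close>

lemma nbhd_base_le:
  assumes "p \<in> road_space r"
  shows "\<exists>N\<in>road_nbhd_base r p. \<forall>q\<in>N. (road_base q, road_base p) \<in> r"
proof (cases p)
  case (Edge x y t)
  then have "0 < t" "t < 1" using assms by (auto simp: road_space_def road_point_def split: if_splits)
  then have "road_seg x y {0<..<1} \<in> road_nbhd_base r p"
    using Edge edge_nbhd_baseI[OF tree, of 0 t 1] by simp
  moreover have "(x, x) \<in> r" using road_base_Field[OF assms] Edge tree_refl[OF tree] by simp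
  moreover have "\<forall>q\<in>road_seg x y {0<..<1}. (road_base q, x) \<in> r"
    using \<open>(x, x) \<in> r\<close> by (auto simp: road_base_point)
  ultimately show ?thesis unfolding Edge road_base.simps by blast
next
  case (Node x)
  then have x: "x \<in> Field r" using assms Node_in_road_space_iff by simp
  note xx = tree_refl[OF tree x]
  show ?thesis
    using x
  proof (cases rule: point_cases[OF tree, consumes 1, case_names minimal succ limit])
    case minimal
    then have "road_star r x 1 \<in> road_nbhd_base r p" using Node by auto
    moreover have "(road_base q, x) \<in> r" if "q \<in> road_star r x 1" for q
      using road_base_star[OF _ that] xx by simp
    ultimately show ?thesis unfolding Node road_base.simps by blast
  next
    case (succ z)
    have "road_star r x 1 \<union> road_seg z x {1 - 1 / real 1<..1} \<in> road_nbhd_base r p"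
      using succ_nbhd_baseI[OF tree succ, of 1] Node by simp
    moreover have "(z, x) \<in> r" using succ by (simp add: immediate_succs_def underS_def)
    then have "(road_base q, x) \<in> r" if "q \<in> road_star r x 1 \<union> road_seg z x {1 - 1 / real 1<..1}" for q
      using that xx road_base_star[of 1 q r x] by (auto simp: road_point_def)
    ultimately show ?thesis unfolding Node road_base.simps by blast
  next
    case limit
    then obtain z where z: "z \<in> underS r x" by (auto simp: limit_level_points_def)
    let ?N = "{p \<in> road_space r. road_less r (Node z) p \<and> (road_less r p (Node x) \<or> p = Node x)}
      \<union> (\<Union>w \<in> {w. z \<in> underS r w \<and> (w, x) \<in> r}. road_star r w 1)"
    have "?N \<in> road_nbhd_base r p" using limit_nbhd_baseI[OF tree limit z, of 1] Node by simp
    moreover have "(road_base q, x) \<in> r" if "q \<in> ?N" for q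
    proof (cases "\<exists>w. (w, x) \<in> r \<and> q \<in> road_star r w 1")
      case True
      then show ?thesis using road_base_star[of 1 q r] by auto
    next
      case False
      then have q: "q \<in> road_space r" "road_less r q (Node x) \<or> q = Node x" using that by blast+
      show ?thesis
      proof (cases q)
        case (Node v)
        then show ?thesis using q xx by (auto simp: underS_def)
      next
        case (Edge v w t)
        then have "w \<in> immediate_succs r v" "(w, x) \<in> r"
          using q by (auto simp: road_space_def road_point_def split: if_splits)
        then have "(v, w) \<in> r" by (simp add: immediate_succs_def underS_def)
        then show ?thesis using Edge tree_trans[OF tree _ \<open>(w, x) \<in> r\<close>] by simp
      qed
    qed
    ultimately show ?thesis unfolding Node road_base.simps by blast
  qed
qed

lemma openin_compl_road_cone: "openin (road_topology r) (road_space r - road_cone r z)"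
  unfolding openin_road_topology[OF tree] road_open_def
proof (intro conjI ballI)
  fix p assume p: "p \<in> road_space r - road_cone r z"
  then obtain N where N: "N \<in> road_nbhd_base r p" "\<forall>q\<in>N. (road_base q, road_base p) \<in> r"
    using nbhd_base_le by blast
  have "N \<subseteq> road_space r"
    using openin_subset[OF openin_road_nbhd_base[OF tree _ N(1)]] p topspace_road_topology[OF tree] by blast
  moreover have "(z, road_base q) \<notin> r" if "q \<in> N" for q
    using that N(2) p tree_trans[OF tree] by (auto simp: road_cone_def)
  ultimately show "\<exists>N\<in>road_nbhd_base r p. N \<subseteq> road_space r - road_cone r z"
    using N(1) by (auto simp: road_cone_def)
qed auto

text \<open>The apex is excluded because its neighbourhoods may reach below z. Any other node of the
  cone is strictly above z; if it is a successor, its immediate predecessor is still at or above z,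
  so the incoming edge stays in the cone.\<close>

lemma nbhd_base_above:
  assumes p: "p \<in> road_cone r z" "p \<noteq> Node z"
  shows "\<exists>N\<in>road_nbhd_base r p. N \<subseteq> road_cone r z - {Node z}"
proof -
  have pS: "p \<in> road_space r" and zp: "(z, road_base p) \<in> r" using p by (auto simp: road_cone_def)
  have "\<exists>N\<in>road_nbhd_base r p. \<forall>q\<in>N. (z, road_base q) \<in> r \<and> q \<noteq> Node z"
  proof (cases p)
    case (Edge x y t)
    then have "0 < t" "t < 1" using pS by (auto simp: road_space_def road_point_def split: if_splits)
    then have "road_seg x y {0<..<1} \<in> road_nbhd_base r p"
      using Edge edge_nbhd_baseI[OF tree, of 0 t 1] by simp
    moreover have "\<forall>q\<in>road_seg x y {0<..<1}. (z, road_base q) \<in> r \<and> q \<noteq> Node z"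
      using zp Edge by (auto simp: road_point_def)
    ultimately show ?thesis by blast
  next
    case (Node x)
    then have x: "x \<in> Field r" using pS Node_in_road_space_iff by simp
    have zx: "z \<in> underS r x" using zp p(2) Node by (auto simp: underS_def)
    have star: "(z, road_base q) \<in> r \<and> q \<noteq> Node z" if "q \<in> road_star r w 1" "z \<in> underS r w" for q w
      using that road_base_star[of 1 q r w] by (auto simp: underS_def)
    show ?thesis
      using x
    proof (cases rule: point_cases[OF tree, consumes 1, case_names minimal succ limit])
      case minimal
      then show ?thesis using zx by (auto simp: minimal_points_def)
    next
      case (succ u)
      have "road_star r x 1 \<union> road_seg u x {1 - 1 / real 1<..1} \<in> road_nbhd_base r p"
        using succ_nbhd_baseI[OF tree succ, of 1] Node by simp
      moreover have "(z, u) \<in> r" using immediate_pred_le[OF tree succ zx] .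
      then have "(z, road_base q) \<in> r \<and> q \<noteq> Node z"
        if "q \<in> road_star r x 1 \<union> road_seg u x {1 - 1 / real 1<..1}" for q
        using that star zx by (auto simp: road_point_def underS_def)
      ultimately show ?thesis by blast
    next
      case limit
      let ?N = "{p \<in> road_space r. road_less r (Node z) p \<and> (road_less r p (Node x) \<or> p = Node x)}
        \<union> (\<Union>w \<in> {w. z \<in> underS r w \<and> (w, x) \<in> r}. road_star r w 1)"
      have "?N \<in> road_nbhd_base r p" using limit_nbhd_baseI[OF tree limit zx, of 1] Node by simp
      moreover have "(z, road_base q) \<in> r \<and> q \<noteq> Node z" if "q \<in> ?N" for q
      proof (cases "\<exists>w. z \<in> underS r w \<and> q \<in> road_star r w 1")
        case True
        then show ?thesis using star by blast
      next
        case False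
        then have "road_less r (Node z) q" using that by blast
        then show ?thesis by (cases q) (auto simp: underS_def)
      qed
      ultimately show ?thesis by blast
    qed
  qed
  then obtain N where N: "N \<in> road_nbhd_base r p" "\<forall>q\<in>N. (z, road_base q) \<in> r \<and> q \<noteq> Node z"
    by blast
  have "N \<subseteq> road_space r"
    using openin_subset[OF openin_road_nbhd_base[OF tree pS N(1)]] topspace_road_topology[OF tree] by blast
  then have "N \<subseteq> road_cone r z - {Node z}" using N(2) by (auto simp: road_cone_def)
  then show ?thesis using N(1) by blast
qed

lemma openin_road_cone_interior: "openin (road_topology r) (road_cone r z - {Node z})"
  unfolding openin_road_topology[OF tree] road_open_def
proof (intro conjI ballI)
  show "road_cone r z - {Node z} \<subseteq> road_space r" by (auto simp: road_cone_def)
  show "\<exists>N\<in>road_nbhd_base r p. N \<subseteq> road_cone r z - {Node z}" if "p \<in> road_cone r z - {Node z}" for p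
    using that by (intro nbhd_base_above) auto
qed

lemma road_nbhd_limit:
  assumes U: "openin (road_topology r) U" "Node x \<in> U" and x: "x \<in> limit_level_points r"
  shows "\<exists>z\<in>underS r x. \<forall>w. z \<in> underS r w \<longrightarrow> (w, x) \<in> r \<longrightarrow> Node w \<in> U"
proof -
  obtain N where N: "N \<in> road_nbhd_base r (Node x)" "N \<subseteq> U"
    using U unfolding openin_road_topology[OF tree] road_open_def by blast
  have "x \<notin> minimal_points r" "\<And>z. x \<notin> immediate_succs r z"
    using x not_minimal_limit[OF tree] not_succ_limit[OF tree] by metis+
  then obtain z n where "z \<in> underS r x" "n \<ge> 1"
    "(\<Union>w \<in> {w. z \<in> underS r w \<and> (w, x) \<in> r}. road_star r w n) \<subseteq> N"
    using N(1) by auto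
  then show ?thesis using N(2) by (intro bexI[of _ z]) (auto simp: road_star_def)
qed

end

section \<open>Following a contraction along points of \<open>S\<close>\<close>

text \<open>The least w \<le> y above all predecessors of x has exactly the predecessors of x, so w
  = x by the Hausdorff condition. Consequently a point outside the cone of a limit x is already
  outside the cone of some z < x.\<close>

lemma hausdorff_tree_limit_le:
  assumes "hausdorff_tree r" and x: "x \<in> limit_level_points r"
    and y: "\<And>z. z \<in> underS r x \<Longrightarrow> (z, y) \<in> r"
  shows "(x, y) \<in> r"
proof -
  have tree: "is_tree r" using assms by (simp add: hausdorff_tree_def)
  define B where "B = {w. (w, y) \<in> r \<and> underS r x \<subseteq> underS r w}"
  have ne: "underS r x \<noteq> {}" and lim: "\<And>z. z \<in> underS r x \<Longrightarrow> \<exists>u\<in>underS r x. z \<in> underS r u"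
    using x by (auto simp: limit_level_points_def)
  have yF: "y \<in> Field r" using ne y by (auto simp: Field_def)
  have "underS r x \<subseteq> underS r y" using lim y underS_trans[OF tree] by blast
  then have "y \<in> B" using tree_refl[OF tree yF] by (auto simp: B_def)
  then obtain w where w: "w \<in> min_els r B" by (rule min_els_below[OF tree _ yF])
  have wB: "(w, y) \<in> r" "underS r x \<subseteq> underS r w" using w by (auto simp: min_els_def B_def)
  have "underS r w \<subseteq> underS r x"
  proof
    fix u assume u: "u \<in> underS r w"
    then have "u \<notin> B" "(u, y) \<in> r"
      using w wB tree_trans[OF tree] underS_le[OF tree] by (auto simp: min_els_def) blast
    then obtain z where z: "z \<in> underS r x" "z \<notin> underS r u" by (auto simp: B_def)
    then have "(u, z) \<in> r" using le_comparable[OF tree \<open>(u, y) \<in> r\<close> y] by blast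
    then show "u \<in> underS r x" using underS_trans'[OF tree] z by blast
  qed
  then have "underS r w = underS r x" using wB by blast
  moreover have "w \<in> Field r" using wB by (auto simp: Field_def)
  ultimately have "w \<in> limit_level_points r" using x by (simp add: limit_level_points_def)
  then have "w = x" using assms(1) x \<open>underS r w = underS r x\<close> by (auto simp: hausdorff_tree_def)
  then show ?thesis using wB by simp
qed

theorem road_space_not_contractible:
  assumes H: "hausdorff_tree r" and preds: "\<And>x. countable (underS r x)"
    and S: "S \<subseteq> Field r" "uncountable S" "thin_sets_countable r S"
  shows "\<not> contractible_space (road_topology r)"
proof
  have tree: "is_tree r" using H by (simp add: hausdorff_tree_def)
  note [dest] = underS_le[OF tree]
  let ?X = "road_topology r" and ?I = "top_of_set {0..1::real}"
  assume "contractible_space ?X"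
  \<comment> \<open>In \<open>contractible_space\<close> the homotopy begins with the identity at
    time 0 and is constant at time 1, and time is the first argument.\<close>
  then obtain a h where h: "continuous_map (prod_topology ?I ?X) ?X h"
    and h0: "\<And>p. h (0, p) = p" and h1: "\<And>p. h (1, p) = a"
    unfolding contractible_space_def homotopic_with_def by auto
  have top: "topspace ?X = road_space r" by (rule topspace_road_topology[OF tree])
  have cont_t: "continuous_map ?I ?X (\<lambda>t. h (t, Node x))" if "x \<in> Field r" for x
  proof -
    have "continuous_map ?I (prod_topology ?I ?X) (\<lambda>t. (t, Node x))"
      using that by (intro continuous_map_pairedI) (auto simp: top Node_in_road_space_iff[OF tree])
    from continuous_map_compose[OF this h] show ?thesis by (simp add: comp_def)
  qed
  have cont_x: "continuous_map ?X ?X (\<lambda>p. h (t, p))" if "t \<in> {0..1}" for t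
  proof -
    have "continuous_map ?X (prod_topology ?I ?X) (\<lambda>p. (t, p))"
      using that by (intro continuous_map_pairedI) auto
    from continuous_map_compose[OF this h] show ?thesis by (simp add: comp_def)
  qed
  have h_space: "h (t, Node x) \<in> road_space r" if "t \<in> {0..1}" "x \<in> Field r" for t x
    using continuous_map_image_subset_topspace[OF cont_t[OF that(2)]] that(1) top by auto
  have anti: "p \<notin> road_cone r w" if "p \<notin> road_cone r z" "(z, w) \<in> r" for p z w
    using that road_cone_mono[OF tree] by blast
  define Q where "Q = \<rat> \<inter> {0..1::real}"
  have Q: "countable Q" "Q \<subseteq> {0..1}" by (auto simp: Q_def countable_rat)
  \<comment> \<open>Rational times keep \<open>F z\<close> countable. A point x not below any
    element of \<open>F z\<close> reflects: if some later point of \<open>S\<close> is in the cone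
    of z at time q, then so is a point of \<open>S\<close> strictly between z and x.\<close>
  define F where "F = (\<lambda>z. \<Union>q\<in>Q. min_els r {s \<in> S. z \<in> underS r s \<and> h (q, Node s) \<in> road_cone r z})"
  have F: "countable (F z)" for z
    unfolding F_def by (intro countable_UN Q countable_min_els[OF tree S(3)] S) auto
  define G where "G = {x \<in> S. x \<in> limit_level_points r \<and> (\<forall>z\<in>underS r x. \<forall>y\<in>F z. (x, y) \<notin> r)}"
  have drop: "\<exists>z\<in>underS r x. \<forall>s\<in>S. (x, s) \<in> r \<longrightarrow> h (q, Node s) \<notin> road_cone r z"
    if x: "x \<in> G" and q: "q \<in> Q" and out: "h (q, Node x) \<notin> road_cone r x" for x q
  proof -
    have xF: "x \<in> Field r" and xl: "x \<in> limit_level_points r" using x S by (auto simp: G_def)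
    have qI: "q \<in> {0..1}" using q Q by blast
    obtain z0 where z0: "z0 \<in> underS r x" "h (q, Node x) \<notin> road_cone r z0"
      using hausdorff_tree_limit_le[OF H xl, of "road_base (h (q, Node x))"] out h_space[OF qI xF]
      by (auto simp: road_cone_def)
    \<comment> \<open>By continuity in space at time q, the nodes just below x have also left the
      cone of z0. A later point of \<open>S\<close> still in the cone of z would reflect to such a
      node.\<close>
    define V where "V = {p \<in> topspace ?X. h (q, p) \<in> road_space r - road_cone r z0}"
    have "openin ?X V"
      unfolding V_def using openin_continuous_map_preimage[OF cont_x[OF qI] openin_compl_road_cone[OF tree]] .
    moreover have "Node x \<in> V"
      using z0 h_space[OF qI xF] xF by (simp add: V_def top Node_in_road_space_iff[OF tree])
    ultimately obtain z1 where z1: "z1 \<in> underS r x"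
      "\<And>w. z1 \<in> underS r w \<Longrightarrow> (w, x) \<in> r \<Longrightarrow> Node w \<in> V"
      using road_nbhd_limit[OF tree _ _ xl] by meson
    obtain z where z: "z \<in> underS r x" "(z0, z) \<in> r" "(z1, z) \<in> r"
    proof -
      have "(z0, z0) \<in> r" "(z1, z1) \<in> r" using z0 z1 underS_Field1 tree_refl[OF tree] by metis+
      then show ?thesis
        using le_comparable[OF tree, of z0 x z1] z0(1) z1(1) that[of z0] that[of z1] by blast
    qed
    have "h (q, Node s) \<notin> road_cone r z" if s: "s \<in> S" "(x, s) \<in> r" for s
    proof
      assume hs: "h (q, Node s) \<in> road_cone r z"
      let ?B = "{s \<in> S. z \<in> underS r s \<and> h (q, Node s) \<in> road_cone r z}"
      have "s \<in> ?B" using s hs underS_trans[OF tree z(1)] by blast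
      moreover have "s \<in> Field r" using s S by blast
      ultimately obtain b where b: "b \<in> min_els r ?B" "(b, s) \<in> r"
        by (rule min_els_below[OF tree])
      then have b': "z \<in> underS r b" "h (q, Node b) \<in> road_cone r z" "b \<in> F z"
        using q by (auto simp: min_els_def F_def)
      then have "(x, b) \<notin> r" using x z(1) by (auto simp: G_def)
      then have "(b, x) \<in> r" using le_comparable[OF tree s(2) b(2)] by blast
      then have "Node b \<in> V" using z1(2) underS_trans'[OF tree z(3) b'(1)] by blast
      then show False using b'(2) anti[OF _ z(2)] by (auto simp: V_def)
    qed
    then show ?thesis using z(1) by blast
  qed
  \<comment> \<open>Avoiding \<open>A q\<close> makes x late enough: if a good point above x is
    outside its own cone at time q, the first good point below it with this property is already
    below x.\<close>
  define A where "A = (\<lambda>q. min_els r {x \<in> G. h (q, Node x) \<notin> road_cone r x})"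
  have A: "countable (A q)" for q
    unfolding A_def by (rule countable_min_els[OF tree S(3)]) (use S in \<open>auto simp: G_def\<close>)
  define L where "L = {s \<in> S. countable {u \<in> S. (s, u) \<in> r}}"
  have "countable L"
  proof -
    have "L \<subseteq> (\<Union>m\<in>min_els r L. {u \<in> S. (m, u) \<in> r})"
    proof
      fix s assume s: "s \<in> L"
      then have "s \<in> Field r" using S by (auto simp: L_def)
      with s obtain m where "m \<in> min_els r L" "(m, s) \<in> r" by (rule min_els_below[OF tree])
      then show "s \<in> (\<Union>m\<in>min_els r L. {u \<in> S. (m, u) \<in> r})" using s by (auto simp: L_def)
    qed
    moreover have "countable (min_els r L)"
      by (rule countable_min_els[OF tree S(3)]) (use S in \<open>auto simp: L_def\<close>)
    moreover have "countable {u \<in> S. (m, u) \<in> r}" if "m \<in> min_els r L" for m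
      using that by (auto simp: min_els_def L_def)
    ultimately show ?thesis by (meson countable_UN countable_subset)
  qed
  \<comment> \<open>The added sets do not depend on z. Avoiding the base of \<open>a\<close> puts x
    outside its own cone at time 1; avoiding \<open>L\<close> leaves uncountably many points of
    \<open>S\<close> above x.\<close>
  have "countable (F z \<union> (\<Union>q\<in>Q. A q) \<union> {road_base a} \<union> L)" for z
    using F A Q \<open>countable L\<close> by auto
  then have "\<exists>x\<in>S. x \<in> limit_level_points r \<and>
      (\<forall>z\<in>underS r x. \<forall>y\<in>F z \<union> (\<Union>q\<in>Q. A q) \<union> {road_base a} \<union> L. (x, y) \<notin> r)"
    by (rule stationary[OF tree S preds])
  then obtain x where x: "x \<in> S" "x \<in> limit_level_points r"
    and avoid: "\<And>z y. z \<in> underS r x \<Longrightarrow> y \<in> F z \<union> (\<Union>q\<in>Q. A q) \<union> {road_base a} \<union> L \<Longrightarrow> (x, y) \<notin> r"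
    by blast
  have xF: "x \<in> Field r" using x S by blast
  obtain z where "z \<in> underS r x" using x(2) by (auto simp: limit_level_points_def)
  note avoid' = avoid[OF this]
  have xG: "x \<in> G" using x avoid by (auto simp: G_def)
  have "x \<notin> L" using avoid' tree_refl[OF tree xF] by blast
  then have "uncountable {s \<in> S. (x, s) \<in> r}" using x by (auto simp: L_def)
  \<comment> \<open>Adding x to the avoided set makes \<open>s\<close> strictly later than
    x.\<close>
  then have "\<exists>s\<in>{s \<in> S. (x, s) \<in> r}. s \<in> limit_level_points r \<and>
      (\<forall>z\<in>underS r s. \<forall>y\<in>F z \<union> {x}. (s, y) \<notin> r)"
    by (intro stationary[OF tree _ _ thin_sets_countable_cone[OF tree S(3,1)] preds])
      (use S(1) F in auto)
  then obtain s where s: "s \<in> S" "(x, s) \<in> r" "s \<in> limit_level_points r"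
    "\<And>z y. z \<in> underS r s \<Longrightarrow> y \<in> F z \<union> {x} \<Longrightarrow> (s, y) \<notin> r"
    by blast
  have sF: "s \<in> Field r" using s S by blast
  have sG: "s \<in> G" using s by (auto simp: G_def)
  obtain z where "z \<in> underS r s" using s(3) by (auto simp: limit_level_points_def)
  then have "(s, x) \<notin> r" using s(4) by blast
  define R where "R = {q \<in> Q. h (q, Node x) \<notin> road_cone r x}"
  have R_eq: "R = {q \<in> Q. h (q, Node s) \<notin> road_cone r s}"
  proof -
    have up: "h (q, Node v) \<notin> road_cone r v"
      if up: "q \<in> Q" "u \<in> G" "v \<in> G" "(u, v) \<in> r" "h (q, Node u) \<notin> road_cone r u" for q u v
    proof -
      obtain z where z: "z \<in> underS r u" "h (q, Node v) \<notin> road_cone r z"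
        using drop[OF up(2,1,5)] up(3,4) by (auto simp: G_def)
      have "z \<in> underS r v" using underS_trans[OF tree z(1) up(4)] .
      then show ?thesis using anti[OF z(2)] by blast
    qed
    have "h (q, Node x) \<notin> road_cone r x" if q: "q \<in> Q" "h (q, Node s) \<notin> road_cone r s" for q
    proof -
      have "s \<in> {x \<in> G. h (q, Node x) \<notin> road_cone r x}" using q sG by blast
      then obtain b where b: "b \<in> A q" "(b, s) \<in> r"
        unfolding A_def using sF by (rule min_els_below[OF tree])
      have "(x, b) \<notin> r" using avoid' b q by blast
      then have "(b, x) \<in> r" using le_comparable[OF tree s(2) b(2)] by blast
      then show ?thesis using up[OF q(1) _ xG] b(1) by (auto simp: A_def min_els_def)
    qed
    then show ?thesis using up[OF _ xG sG s(2)] by (auto simp: R_def)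
  qed
  have "(x, road_base a) \<notin> r" using avoid' by blast
  then have R1: "1 \<in> R" using h1 by (simp add: R_def Q_def road_cone_def)
  have R01: "R \<subseteq> {0..1}" using Q by (auto simp: R_def)
  define \<tau> where "\<tau> = Inf R"
  have bdd: "bdd_below R" using R01 by (meson bdd_below_Icc bdd_below_mono)
  have \<tau>_le: "\<tau> \<le> q" if "q \<in> R" for q unfolding \<tau>_def using that bdd by (rule cInf_lower)
  have \<tau>_ge: "0 \<le> \<tau>" unfolding \<tau>_def using R1 R01 by (intro cInf_greatest) auto
  have \<tau>: "\<tau> \<in> {0..1}" using \<tau>_ge \<tau>_le[OF R1] by simp
  have preimage: "\<exists>e>0. \<forall>t\<in>{0..1}. dist t \<tau> < e \<longrightarrow> h (t, Node s) \<in> U"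
    if "openin ?X U" "h (\<tau>, Node s) \<in> U" for U
  proof -
    have "openin ?I {t \<in> topspace ?I. h (t, Node s) \<in> U}"
      by (rule openin_continuous_map_preimage[OF cont_t[OF sF] that(1)])
    then show ?thesis using that(2) \<tau> unfolding openin_euclidean_subtopology_iff by fastforce
  qed
  have "h (\<tau>, Node s) \<in> road_cone r s"
  proof (rule ccontr)
    assume out: "h (\<tau>, Node s) \<notin> road_cone r s"
    then have "h (\<tau>, Node s) \<in> road_space r - road_cone r s" using h_space[OF \<tau> sF] by blast
    from preimage[OF openin_compl_road_cone[OF tree] this] obtain e where e: "e > 0"
      "\<And>t. t \<in> {0..1} \<Longrightarrow> dist t \<tau> < e \<Longrightarrow> h (t, Node s) \<notin> road_cone r s" by blast
    have "h (0, Node s) \<in> road_cone r s"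
      using h0 sF tree_refl[OF tree sF] by (simp add: road_cone_def Node_in_road_space_iff[OF tree])
    then have "0 < \<tau>" using out \<tau>_ge by (cases "\<tau> = 0") auto
    then obtain q where q: "q \<in> \<rat>" "max 0 (\<tau> - e) < q" "q < \<tau>"
      \<comment> \<open>A rational time just before \<tau> at which \<open>s\<close> is still
        outside its cone would belong to \<open>R\<close>, below its infimum.\<close>
      using Rats_dense_in_real[of "max 0 (\<tau> - e)" \<tau>] e(1) by auto
    then have "q \<in> R" unfolding R_eq using \<tau> e(2)[of q] by (auto simp: Q_def dist_real_def)
    then show False using \<tau>_le q(3) by fastforce
  qed
  moreover have "road_cone r s \<subseteq> road_cone r x - {Node x}"
    using road_cone_mono[OF tree s(2)] \<open>(s, x) \<notin> r\<close> by (auto simp: road_cone_def)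
  ultimately have "h (\<tau>, Node s) \<in> road_cone r x - {Node x}" by blast
  from preimage[OF openin_road_cone_interior[OF tree] this] obtain e where e: "e > 0"
    "\<And>t. t \<in> {0..1} \<Longrightarrow> dist t \<tau> < e \<Longrightarrow> h (t, Node s) \<in> road_cone r x" by blast
  \<comment> \<open>At this time \<open>s\<close> is above x by continuity, yet \<open>drop\<close>
    applied to x puts \<open>s\<close> outside the cone of some z < x.\<close>
  obtain q where q: "q \<in> R" "q < \<tau> + e"
    using cInf_lessD[of R "\<tau> + e"] R1 e(1) unfolding \<tau>_def by auto
  then have "h (q, Node s) \<in> road_cone r x" using e(2)[of q] \<tau>_le[of q] R01 by (auto simp: dist_real_def)
  moreover obtain z where "z \<in> underS r x" "h (q, Node s) \<notin> road_cone r z"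
    using drop[OF xG, of q] q(1) s(1,2) by (auto simp: R_def)
  ultimately show False using anti by blast
qed

section \<open>Consequences of height \<omega>1, and the conclusion\<close>

lemma uncountable_Field_omega1: "uncountable (Field omega1)"
proof
  assume "countable (Field omega1)"
  then have "(card_of (Field omega1), natLeq) \<in> ordLeq"
    by (meson card_of_nat countable_card_of_nat ordLeq_ordIso_trans)
  moreover have "Card_order omega1" "(natLeq, omega1) \<in> ordLess"
    unfolding omega1_def by (simp_all add: natLeq_Card_order cardSuc_Card_order cardSuc_greater)
  ultimately show False
    using card_of_Field_ordIso not_ordLess_ordLeq ordIso_ordLeq_trans ordIso_symmetric by metis
qed

text \<open>An uncountable set of predecessors has order type at least \<omega>1. Equality would put
  x on the empty level \<omega>1; otherwise a proper initial segment of type \<omega>1 consists of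
  the predecessors of some y < x, which lies on that level.\<close>

lemma has_height_omega1_countable_underS:
  assumes tree: "is_tree r" and height: "has_height r omega1"
  shows "countable (underS r x)"
proof (rule ccontr)
  assume unc: "uncountable (underS r x)"
  let ?R = "\<lambda>x. Restr r (underS r x)"
  have WF: "well_order_on (underS r y) (?R y)" if "y \<in> Field r" for y
    using tree that by (auto simp: is_tree_def)
  have x: "x \<in> Field r" using unc underS_Field2 by (metis countable_empty ex_in_conv)
  have Fx: "Field (?R x) = underS r x" and Wx: "Well_order (?R x)"
    using WF[OF x] well_order_on_Well_order by blast+
  have empty: "(?R y, omega1) \<notin> ordIso" if "y \<in> Field r" for y
    using height that by (auto simp: has_height_def tree_level_def)
  have W: "Well_order omega1" using height by (simp add: has_height_def)
  have "(?R x, omega1) \<notin> ordLess"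
  proof
    assume "(?R x, omega1) \<in> ordLess"
    then have "(card_of (underS r x), omega1) \<in> ordLess"
      using card_of_least[OF WF[OF x]] ordLeq_ordLess_trans by blast
    then have "(card_of (underS r x), natLeq) \<in> ordLeq"
      unfolding omega1_def using cardSuc_ordLess_ordLeq[OF natLeq_Card_order card_of_Card_order]
      by (meson card_of_Card_order cardSuc_ordLeq_ordLess natLeq_Card_order)
    then show False using unc countable_card_le_natLeq by blast
  qed
  then have "(omega1, ?R x) \<in> ordLess"
    using empty[OF x] W Wx not_ordLess_iff_ordLeq ordLeq_iff_ordLess_or_ordIso ordIso_symmetric by metis
  then obtain y where y: "y \<in> underS r x" "(omega1, Restr (?R x) (underS (?R x) y)) \<in> ordIso"
    using ordLess_iff_ordIso_Restr[OF Wx W] Fx by auto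
  have "underS (?R x) y = underS r y"
    using y(1) underS_trans[OF tree _ underS_le[OF tree y(1)]] by (auto simp: underS_def)
  moreover have "underS r y \<subseteq> underS r x"
    using y(1) underS_trans[OF tree _ underS_le[OF tree y(1)]] by blast
  then have "Restr (?R x) (underS r y) = ?R y" by blast
  ultimately have "(?R y, omega1) \<in> ordIso" using y(2) ordIso_symmetric by metis
  then show False using empty underS_Field1[OF y(1)] by blast
qed

text \<open>Choose a point on each level below \<omega>1. Distinct initial segments of \<omega>1 are
  not isomorphic, so the choice is injective.\<close>

lemma has_height_omega1_uncountable_Field:
  assumes "has_height r omega1"
  shows "uncountable (Field r)"
proof
  assume c: "countable (Field r)"
  have W: "Well_order omega1"
    and level: "\<And>\<alpha> :: nat set rel. (\<alpha>, omega1) \<in> ordLess \<Longrightarrow> tree_level r \<alpha> \<noteq> {}"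
    using assms by (auto simp: has_height_def)
  let ?R = "\<lambda>a. Restr omega1 (underS omega1 a)"
  have "\<forall>a\<in>Field omega1. \<exists>x. x \<in> tree_level r (?R a)"
    using level underS_Restr_ordLess[OF W] by (metis Field_def ex_in_conv empty_iff)
  then obtain f where f: "\<And>a. a \<in> Field omega1 \<Longrightarrow> f a \<in> tree_level r (?R a)" by metis
  have "inj_on f (Field omega1)"
  proof (rule inj_onI)
    fix a b assume ab: "a \<in> Field omega1" "b \<in> Field omega1" "f a = f b"
    have iso: "(?R a, ?R b) \<in> ordIso"
      using f[OF ab(1)] f[OF ab(2)] ab(3) ordIso_transitive ordIso_symmetric
      unfolding tree_level_def by (metis (mono_tags, lifting) mem_Collect_eq)
    show "a = b"
    proof (rule ccontr)
      assume "a \<noteq> b"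
      have less: "(?R c, ?R d) \<in> ordLess" if "c \<noteq> d" "(c, d) \<in> omega1" for c d
      proof -
        have wo: "wo_rel omega1" by (simp add: wo_rel_def W)
        have "underS omega1 c \<subseteq> underS omega1 d" using underS_incr[OF wo_rel.TRANS[OF wo] wo_rel.ANTISYM[OF wo] that(2)] .
        moreover have "c \<in> underS omega1 d - underS omega1 c" using that by (simp add: underS_def)
        ultimately show ?thesis
          using ofilter_subset_ordLess[OF W wo_rel.underS_ofilter[OF wo] wo_rel.underS_ofilter[OF wo], of c d] by blast
      qed
      have "(a, b) \<in> omega1 \<or> (b, a) \<in> omega1"
        using wo_rel.TOTALS[of omega1] ab W by (simp add: wo_rel_def)
      then show False
        using less \<open>a \<noteq> b\<close> iso not_ordLess_ordIso ordIso_symmetric by metis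
    qed
  qed
  moreover have "f ` Field omega1 \<subseteq> Field r" using f by (auto simp: tree_level_def)
  ultimately have "countable (Field omega1)" using c countable_image_inj_on countable_subset by blast
  then show False using uncountable_Field_omega1 by blast
qed

theorem corollary1p4:
  fixes T :: "'a rel"
  assumes "hausdorff_tree T" and "has_height T omega1"
  shows "((\<exists>S. S \<subseteq> Field T \<and> uncountable S \<and>
              omega1_compact_space (subtopology (tree_topology T) S)) \<longrightarrow>
            \<not> contractible_space (road_topology T)) \<and>
         (suslin_tree T \<longrightarrow>
            (\<exists>S. S \<subseteq> Field T \<and> uncountable S \<and>
              omega1_compact_space (subtopology (tree_topology T) S)) \<and>
            \<not> contractible_space (road_topology T))"
proof -
  have tree: "is_tree T" using assms by (simp add: hausdorff_tree_def)
  note preds = has_height_omega1_countable_underS[OF tree assms(2)]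
  have main: "\<not> contractible_space (road_topology T)"
    if "S \<subseteq> Field T" "uncountable S" "omega1_compact_space (subtopology (tree_topology T) S)" for S
    using that(3) unfolding omega1_compact_iff_thin_sets_countable[OF tree that(1)]
    by (rule road_space_not_contractible[OF assms(1) preds that(1,2)])
  \<comment> \<open>In a Suslin tree the whole tree serves as \<open>S\<close>.\<close>
  have "omega1_compact_space (subtopology (tree_topology T) (Field T))" if "suslin_tree T"
    unfolding omega1_compact_iff_thin_sets_countable[OF tree order_refl]
    using that by (intro thin_sets_countable_if_countable_antichains[OF tree preds]) (simp add: suslin_tree_def)
  then show ?thesis
    using main has_height_omega1_uncountable_Field[OF assms(2)] order_refl[of "Field T"] by metis
qed

end
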